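(* Let $Y_{ij}=\beta'\mathbf{x}_{ij}+\varepsilon_{ij}$, $i=1,\dots,m$, $j=1,\dots,n$, $N=mn$, be a sample from the linear model $Y=\beta'\mathbf{x}+\varepsilon$ with $\beta\in\mathbb{R}^p$, $p$ fixed, where the error has mean-certainty ($\mathbb{E}[\varepsilon]=-\mathbb{E}[-\varepsilon]=0$) but possibly uncertain variance. Suppose that for each $i$ the errors $\varepsilon_{i1},\dots,\varepsilon_{in}$ are independent and identically distributed, with common distribution $F_i$. Put $\sigma_i^2=E(\varepsilon_{ij}^2)$ and $\sigma_{i_*}^2=\max_{1\le i\le m}\sigma_i^2$, and assume $\sigma_{i_*}^2>\sigma_i^2$ for all $i\neq i_*$. Let $$\hat\beta_G=\arg\min_{\beta\in\mathbb{R}^p}\max_{1\le i\le m}\frac1n\sum_{j=1}^n\left[Y_{ij}-\beta'\mathbf{x}_{ij}\right]^2 .$$ If $E[\mathbf{x}\mathbf{x}']$ is a positive definite matrix and $n\to\infty$ as $N\to\infty$, then $$\sqrt n(\hat\beta_G-\beta)\stackrel{d}{\longrightarrow}N\left(0,\sigma_{i_*}^2(E[\mathbf{x}\mathbf{x}'])^{-1}\right)\qquad(N\to\infty),$$ where $\stackrel{d}{\longrightarrow}$ is convergence in distribution and the limit is a classical normal distribution.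
   Context: A prime denotes transpose; in the conclusion $\beta$ denotes the true parameter. The covariate vectors $\mathbf{x}_{ij}$ are independent and identically distributed copies of $\mathbf{x}$, which has a certain (single, classical) distribution $F_{\mathbf{x}}$, and they are independent of the errors. The error $\varepsilon$ is defined on a sublinear expectation space $(\Omega,\mathcal{H},\mathbb{E})$, where $\mathcal{H}$ is a linear space of real functions on $\Omega$ containing linear and quadratic functions of $\varepsilon$, and $\mathbb{E}:\mathcal{H}\to\mathbb{R}$ is monotone, preserves constants, is sub-additive and is positively homogeneous. By the representation theorem, $\mathbb{E}$ is a supremum of classical linear expectations. In the sampling setting considered here, the number $m$ of groups equals the (finite) number of distributions in the representing family $\{F_1,\dots,F_m\}$, so that $\mathbb{E}[g(\varepsilon)]=\max_{1\le i\le m}E_{F_i}[g(\varepsilon)]$. Thus, within each group $i$, the errors follow the classical distribution $F_i$, which has mean zero by mean-certainty and finite variance. $E$ denotes the classical linear expectation. *)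

theory Defs
  imports "HOL-Probability.Probability"
begin

section \<open>Sublinear expectation spaces\<close>

text \<open>The underlying space \<open>\<Omega>\<close> is the type \<open>'o\<close>; there is no \<open>\<sigma>\<close>-algebra on it.\<close>

locale sublinear_expectation_space =
  fixes H :: "('o \<Rightarrow> real) set" and EE :: "('o \<Rightarrow> real) \<Rightarrow> real"
  assumes H_const: "(\<lambda>_. c) \<in> H"
    and H_add: "X \<in> H \<Longrightarrow> Y \<in> H \<Longrightarrow> (\<lambda>\<omega>. X \<omega> + Y \<omega>) \<in> H"
    and H_scale: "X \<in> H \<Longrightarrow> (\<lambda>\<omega>. c * X \<omega>) \<in> H"
    and monotone: "X \<in> H \<Longrightarrow> Y \<in> H \<Longrightarrow> (\<And>\<omega>. X \<omega> \<le> Y \<omega>) \<Longrightarrow> EE X \<le> EE Y"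
    and constant_preserving: "EE (\<lambda>_. c) = c"
    and sub_additive: "X \<in> H \<Longrightarrow> Y \<in> H \<Longrightarrow> EE (\<lambda>\<omega>. X \<omega> + Y \<omega>) \<le> EE X + EE Y"
    and positively_homogeneous: "X \<in> H \<Longrightarrow> 0 \<le> c \<Longrightarrow> EE (\<lambda>\<omega>. c * X \<omega>) = c * EE X"

definition mean_certain_zero :: "(('o \<Rightarrow> real) \<Rightarrow> real) \<Rightarrow> ('o \<Rightarrow> real) \<Rightarrow> bool" where
  "mean_certain_zero EE \<epsilon> \<longleftrightarrow> EE \<epsilon> = - EE (\<lambda>\<omega>. - \<epsilon> \<omega>) \<and> EE \<epsilon> = 0"

text \<open>Integrability has to be demanded explicitly, because the Bochner integral of a
  non-integrable function is \<open>0\<close>. Applied to the identity and to the square, it yields the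
  finite first and second moments of every \<open>F i\<close>.\<close>

definition represented_by ::
  "('o \<Rightarrow> real) set \<Rightarrow> (('o \<Rightarrow> real) \<Rightarrow> real) \<Rightarrow> ('o \<Rightarrow> real) \<Rightarrow> nat \<Rightarrow> (nat \<Rightarrow> real measure) \<Rightarrow> bool"
where
  "represented_by H EE \<epsilon> m F \<longleftrightarrow>
     (\<forall>i\<in>{1..m}. real_distribution (F i)) \<and>
     (\<forall>g \<in> borel_measurable borel. (\<lambda>\<omega>. g (\<epsilon> \<omega>)) \<in> H \<longrightarrow>
        (\<forall>i\<in>{1..m}. integrable (F i) g) \<and>
        EE (\<lambda>\<omega>. g (\<epsilon> \<omega>)) = (MAX i\<in>{1..m}. (\<integral>y. g y \<partial>F i)))"


section \<open>The estimation criterion\<close>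

text \<open>The arguments \<open>y\<close> and \<open>x\<close> are one realization of the responses and covariates.\<close>

definition max_group_mse ::
  "nat \<Rightarrow> nat \<Rightarrow> (nat \<Rightarrow> nat \<Rightarrow> real) \<Rightarrow> (nat \<Rightarrow> nat \<Rightarrow> real^'p) \<Rightarrow> real^'p \<Rightarrow> real"
where
  "max_group_mse m n y x b =
     (MAX i\<in>{1..m}. (1 / real n) * (\<Sum>j=1..n. (y i j - b \<bullet> x i j)\<^sup>2))"


section \<open>Independence of random elements of different types\<close>

text \<open>The library's \<open>indep_var\<close> needs both random elements to have the same type.\<close>

definition independent_pair ::
  "'w measure \<Rightarrow> 'a measure \<Rightarrow> ('w \<Rightarrow> 'a) \<Rightarrow> 'b measure \<Rightarrow> ('w \<Rightarrow> 'b) \<Rightarrow> bool"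
where
  "independent_pair M S U T V \<longleftrightarrow>
     U \<in> measurable M S \<and> V \<in> measurable M T \<and>
     prob_space.indep_set M {U -` B \<inter> space M | B. B \<in> sets S} {V -` B \<inter> space M | B. B \<in> sets T}"


section \<open>Matrices, normal laws and convergence in distribution\<close>

definition outer_square :: "real^'p \<Rightarrow> real^'p^'p" where
  "outer_square v = (\<chi> a b. v $ a * v $ b)"

definition positive_definite :: "real^'p^'p \<Rightarrow> bool" where
  "positive_definite S \<longleftrightarrow> transpose S = S \<and> (\<forall>v. v \<noteq> 0 \<longrightarrow> 0 < v \<bullet> (S *v v))"

definition std_normal_vec :: "(real^'p) measure" where
  "std_normal_vec = density lborel (\<lambda>z. ennreal (\<Prod>a\<in>UNIV. std_normal_density (z $ a)))"

text \<open>\<open>N(\<mu>, \<Sigma>)\<close> is the law of \<open>\<mu> + A Z\<close> with \<open>Z\<close> standard normal and \<open>A A' = \<Sigma>\<close>; this law does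
  not depend on the choice of \<open>A\<close>. A density is not used in the definition, so that
  singular \<open>\<Sigma>\<close> is covered (with a single group, the error variance may be zero).\<close>

definition is_normal_law :: "real^'p \<Rightarrow> real^'p^'p \<Rightarrow> (real^'p) measure \<Rightarrow> bool" where
  "is_normal_law \<mu> S L \<longleftrightarrow>
     (\<exists>A :: real^'p^'p. A ** transpose A = S \<and> L = distr std_normal_vec borel (\<lambda>z. \<mu> + A *v z))"

text \<open>The library's \<open>weak_conv_m\<close> is defined through distribution functions on the real line
  only.\<close>

definition converges_in_distribution ::
  "'w measure \<Rightarrow> (nat \<Rightarrow> 'w \<Rightarrow> real^'p) \<Rightarrow> (real^'p) measure \<Rightarrow> bool"
where
  "converges_in_distribution M X L \<longleftrightarrow>
     (\<forall>f :: real^'p \<Rightarrow> real. continuous_on UNIV f \<and> bounded (range f) \<longrightarrow>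
        (\<lambda>n. \<integral>\<omega>. f (X n \<omega>) \<partial>M) \<longlonglongrightarrow> (\<integral>v. f v \<partial>L))"

end

theory Submission
  imports Defs
begin

text \<open>
  Write \<open>d = b - \<beta>\<close>. The criterion of group \<open>i\<close> is the quadratic polynomial
  \<open>s i - 2 (d \<bullet> g i) + d \<bullet> (S i *v d)\<close>, where \<open>s i\<close>, \<open>g i\<close> and \<open>S i\<close> are the sample means of
  the squared errors, of the scores (error times covariate) and of the squared covariates \<open>x x'\<close>. By the law of
  large numbers these means tend to \<open>(\<sigma> i)\<^sup>2\<close>, \<open>0\<close> and \<open>\<Sigma> = E[x x']\<close>. Near the true parameter the criteria are
  therefore ordered like the variances, and the strictly largest variance singles out group \<open>istar\<close>.
  The least squares estimator of that group is close to \<open>\<beta>\<close>, so the maximum over all groups is attained by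
  \<open>istar\<close> there; as the maximum is nowhere below the criterion of \<open>istar\<close>, that estimator is the unique
  minimizer of the maximum (\<open>minimizer_of_max_of_quadratics\<close>). With probability tending to one,
  the estimator \<open>\<beta>hat\<close> is thus ordinary least squares in group \<open>istar\<close>, and its asymptotic normality is the classical one.

  Convergence in distribution is obtained through characteristic functions. The scaled estimation error
  \<open>T\<close> solves \<open>S istar *v T = W\<close>, where \<open>W\<close> is the normalised sum of scores, and is compared with the solution \<open>V\<close> of
  \<open>\<Sigma> *v V = W\<close>. The difference tends to \<open>0\<close> in probability, because \<open>S istar\<close> is close to \<open>\<Sigma>\<close> and \<open>W\<close> is tight
  (\<open>solution_perturbation\<close>, \<open>scaled_score_tight\<close>); linear functionals of \<open>W\<close> obey the one-dimensional central limit
  theorem (\<open>scaled_score_clt\<close>). This identifies the limit of the characteristic functions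
  (\<open>max_criterion_minimizer_iexp_limit\<close>), and a continuity theorem in several dimensions
  (\<open>levy_continuity_vec\<close>, by Gaussian smoothing) turns it into convergence of the integrals of bounded continuous functions.

  Covariates and errors are assumed to have second moments only, so the law of large numbers is proved by truncation for
  summands with a first moment (\<open>weak_law_mean_real\<close>).
\<close>

section \<open>Quadratic criteria and their maximum\<close>

text \<open>The norm of a matrix is its Euclidean (Frobenius) norm as an element of \<open>real^'n^'m\<close>, so this is
  Cauchy-Schwarz applied to each row.\<close>

lemma norm_matrix_vector_mult_le: "norm (A *v x) \<le> norm A * norm x"
  for A :: "real^'n^'m" and x :: "real^'n"
proof -
  have "norm (A *v x) \<le> L2_set (\<lambda>i. norm (A $ i) * norm x) UNIV"
    unfolding norm_vec_def[of "A *v x"]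
    by (rule L2_set_mono) (auto simp: matrix_vector_mul_component Cauchy_Schwarz_ineq2)
  also have "\<dots> = norm A * norm x"
    by (simp add: L2_set_left_distrib norm_vec_def)
  finally show ?thesis .
qed

lemma inner_symmetric_matrix:
  fixes S :: "real^'n^'n"
  assumes "transpose S = S"
  shows "u \<bullet> (S *v w) = w \<bullet> (S *v u)"
proof -
  have "u \<bullet> (S *v w) = (transpose S *v u) \<bullet> w"
    by (simp add: dot_lmul_matrix)
  then show ?thesis
    using assms by (simp add: inner_commute)
qed

text \<open>A positive definite form attains a positive minimum on the compact unit sphere; homogeneity carries
  the bound to all vectors.\<close>

lemma positive_definite_coercive:
  fixes S :: "real^'p^'p"
  assumes "positive_definite S"
  obtains c where "c > 0" "\<And>v. c * (norm v)\<^sup>2 \<le> v \<bullet> (S *v v)"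
proof -
  have "continuous_on (sphere 0 1) (\<lambda>v. v \<bullet> (S *v v))"
    by (intro continuous_intros matrix_vector_mult_linear_continuous_on)
  moreover have "sphere (0::real^'p) 1 \<noteq> {}" by auto
  ultimately obtain v0 where v0: "v0 \<in> sphere 0 1"
    and le: "\<forall>v\<in>sphere 0 1. v0 \<bullet> (S *v v0) \<le> v \<bullet> (S *v v)"
    using continuous_attains_inf[OF compact_sphere] by blast
  have "v0 \<noteq> 0" using v0 by auto
  then have pos: "v0 \<bullet> (S *v v0) > 0"
    using assms by (auto simp: positive_definite_def)
  have "v0 \<bullet> (S *v v0) * (norm v)\<^sup>2 \<le> v \<bullet> (S *v v)" for v
  proof (cases "v = 0")
    case False
    then have "v0 \<bullet> (S *v v0) \<le> (v /\<^sub>R norm v) \<bullet> (S *v (v /\<^sub>R norm v))"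
      by (intro le[rule_format]) auto
    also have "\<dots> = v \<bullet> (S *v v) / (norm v)\<^sup>2"
      by (simp add: matrix_vector_mult_scaleR power2_eq_square divide_simps)
    finally show ?thesis using False by (simp add: divide_simps)
  qed simp
  with pos show thesis by (rule that)
qed

lemma coercive_matrix_solvable:
  fixes S :: "real^'p^'p"
  assumes "c > 0" "\<And>v. c * (norm v)\<^sup>2 \<le> v \<bullet> (S *v v)"
  obtains d where "S *v d = g"
proof -
  have "inj ((*v) S)"
  proof (subst linear_injective_0[OF matrix_vector_mul_linear], intro allI impI)
    fix v assume "S *v v = 0"
    then have "c * (norm v)\<^sup>2 \<le> 0" using assms(2)[of v] by simp
    then show "v = 0" using \<open>c > 0\<close> by (simp add: mult_le_0_iff)
  qed
  then have "surj ((*v) S)"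
    using linear_injective_imp_surjective[OF matrix_vector_mul_linear] by blast
  then show thesis using that by (metis surjD)
qed

text \<open>Gram-Schmidt for the inner product \<open>u \<bullet> (S *v w)\<close>. As long as fewer vectors than the dimension have
  been chosen, some \<open>v\<close> lies outside their span, and subtracting its projections leaves a nonzero
  vector that can be normalised.\<close>

lemma conjugate_basis_exists:
  fixes S :: "real^'p^'p"
  assumes S: "positive_definite S" and "finite (K :: 'p set)"
  shows "\<exists>u. \<forall>a\<in>K. \<forall>b\<in>K. u a \<bullet> (S *v u b) = (if a = b then 1 else 0)"
  using \<open>finite K\<close>
proof induction
  case (insert k K)
  then obtain u where u: "\<And>a b. a \<in> K \<Longrightarrow> b \<in> K \<Longrightarrow> u a \<bullet> (S *v u b) = (if a = b then 1 else 0)"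
    by metis
  have sym: "transpose S = S" using S by (simp add: positive_definite_def)
  have "card K < CARD('p)"
    using insert.hyps by (metis finite card_insert_disjoint card_mono less_eq_Suc_le subset_UNIV)
  then have "dim (span (u ` K)) < DIM(real^'p)"
    using dim_le_card'[of "u ` K"] card_image_le[of K u] by simp
  then have "span (u ` K) \<noteq> UNIV" by (metis dim_UNIV less_irrefl)
  then obtain v where v: "v \<notin> span (u ` K)" by auto
  define w where "w = v - (\<Sum>a\<in>K. (v \<bullet> (S *v u a)) *\<^sub>R u a)"
  have "w \<noteq> 0"
  proof
    assume "w = 0"
    then have "v = (\<Sum>a\<in>K. (v \<bullet> (S *v u a)) *\<^sub>R u a)" by (simp add: w_def)
    also have "\<dots> \<in> span (u ` K)" by (intro span_sum span_scale span_base imageI)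
    finally show False using v by simp
  qed
  then have pos: "w \<bullet> (S *v w) > 0" using S by (simp add: positive_definite_def)
  define u' where "u' = u(k := w /\<^sub>R sqrt (w \<bullet> (S *v w)))"
  have orth: "w \<bullet> (S *v u b) = 0" if "b \<in> K" for b
  proof -
    have "(\<Sum>a\<in>K. (v \<bullet> (S *v u a)) * (u a \<bullet> (S *v u b))) = (\<Sum>a\<in>K. if a = b then v \<bullet> (S *v u b) else 0)"
      using that by (intro sum.cong) (auto simp: u)
    also have "\<dots> = v \<bullet> (S *v u b)" using that insert.hyps by simp
    finally show ?thesis by (simp add: w_def inner_diff_left inner_sum_left)
  qed
  have "u' a \<bullet> (S *v u' b) = (if a = b then 1 else 0)" if "a \<in> insert k K" "b \<in> insert k K" for a b
  proof -
    have "u a \<bullet> (S *v w) = 0" if "a \<in> K" for a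
      using orth[OF that] inner_symmetric_matrix[OF sym] by metis
    moreover have "w \<bullet> (S *v w) / (sqrt (w \<bullet> (S *v w)) * sqrt (w \<bullet> (S *v w))) = 1"
      using pos by simp
    ultimately show ?thesis
      using that insert.hyps orth u
      by (auto simp: u'_def matrix_vector_mult_scaleR divide_simps)
  qed
  then show ?case by blast
qed simp

text \<open>If the rows of \<open>R\<close> are \<open>S\<close>-orthonormal, then
  \<open>R S R' = 1\<close>, so \<open>R\<close> is invertible and \<open>R' R\<close> is the inverse of \<open>S\<close>. This factor produces the limiting
  normal law as a linear image of the standard one.\<close>

lemma positive_definite_inverse_factor:
  fixes S :: "real^'p^'p"
  assumes S: "positive_definite S"
  obtains U :: "real^'p^'p" where "U ** transpose U = matrix_inv S" "S ** matrix_inv S = mat 1"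
proof -
  obtain u :: "'p \<Rightarrow> real^'p" where u: "\<And>a b. u a \<bullet> (S *v u b) = (if a = b then 1 else 0)"
    using conjugate_basis_exists[OF S, of UNIV] by auto
  define R :: "real^'p^'p" where "R = (\<chi> a. u a)"
  have "R ** (S ** transpose R) = mat 1"
  proof -
    have "(S ** transpose R) $ c $ b = (S *v u b) $ c" for b c
      by (simp add: matrix_matrix_mult_def matrix_vector_mult_def R_def transpose_def)
    then have "(R ** (S ** transpose R)) $ a $ b = u a \<bullet> (S *v u b)" for a b
      by (subst matrix_matrix_mult_def) (simp add: R_def inner_vec_def)
    then show ?thesis by (simp add: u vec_eq_iff mat_def)
  qed
  then have "S ** transpose R ** R = mat 1"
    using matrix_left_right_inverse by blast
  then have 1: "S ** (transpose R ** R) = mat 1" by (simp add: matrix_mul_assoc)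
  then have 2: "(transpose R ** R) ** S = mat 1"
    using matrix_left_right_inverse by blast
  have "invertible S" using 1 2 by (auto simp: invertible_def)
  then have inv: "S ** matrix_inv S = mat 1" by (metis (mono_tags, lifting) invertible_def matrix_inv_def someI_ex)
  have "matrix_inv S = ((transpose R ** R) ** S) ** matrix_inv S" by (simp add: 2)
  also have "\<dots> = transpose R ** R" by (simp only: inv matrix_mul_assoc[symmetric] matrix_mul_rid)
  finally show thesis using inv by (intro that[of "transpose R"]) auto
qed

lemma coercive_perturbation:
  fixes S Sg :: "real^'p^'p"
  assumes coercive: "\<And>w. c * (norm w)\<^sup>2 \<le> w \<bullet> (Sg *v w)" and close: "norm (S - Sg) \<le> c / 2"
  shows "c / 2 * (norm w)\<^sup>2 \<le> w \<bullet> (S *v w)"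
proof -
  have "\<bar>w \<bullet> ((S - Sg) *v w)\<bar> \<le> norm w * norm ((S - Sg) *v w)"
    by (rule Cauchy_Schwarz_ineq2)
  also have "\<dots> \<le> norm w * (norm (S - Sg) * norm w)"
    by (intro mult_left_mono norm_matrix_vector_mult_le) auto
  also have "\<dots> \<le> norm w * (c / 2 * norm w)"
    using close by (intro mult_left_mono mult_right_mono) auto
  finally have "\<bar>w \<bullet> ((S - Sg) *v w)\<bar> \<le> c / 2 * (norm w)\<^sup>2"
    by (simp add: power2_eq_square mult_ac)
  moreover have "w \<bullet> (S *v w) = w \<bullet> (Sg *v w) + w \<bullet> ((S - Sg) *v w)"
    by (simp add: matrix_vector_mult_diff_rdistrib inner_diff_right)
  ultimately show ?thesis using coercive[of w] by (simp add: abs_le_iff)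
qed

lemma norm_le_of_coercive:
  fixes S :: "real^'p^'p"
  assumes c: "c > 0" and coercive: "c * (norm w)\<^sup>2 \<le> w \<bullet> (S *v w)"
  shows "c * norm w \<le> norm (S *v w)"
proof (cases "w = 0")
  case False
  have "c * (norm w)\<^sup>2 \<le> norm w * norm (S *v w)"
    using coercive norm_cauchy_schwarz[of w "S *v w"] by linarith
  then show ?thesis using False by (simp add: power2_eq_square)
qed simp

text \<open>The difference satisfies \<open>Sg *v (T - V) = (Sg - S) *v T\<close>, and the coercivity of the fixed matrix \<open>Sg\<close> bounds its
  norm. In the application \<open>S\<close> is the random sample second moment matrix and \<open>Sg\<close> its limit.\<close>

lemma solution_perturbation:
  fixes S Sg :: "real^'p^'p"
  assumes c: "c > 0" and coercive: "\<And>w. c * (norm w)\<^sup>2 \<le> w \<bullet> (Sg *v w)"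
    and close: "norm (S - Sg) \<le> \<delta>" "\<delta> \<le> c / 2" and T: "S *v T = W" and V: "Sg *v V = W"
  shows "norm (T - V) \<le> 2 * \<delta> / c\<^sup>2 * norm W"
proof -
  have "c / 2 * norm T \<le> norm W"
    using norm_le_of_coercive[of "c / 2" T S] coercive_perturbation[OF coercive, of S T] close c T by simp
  then have T_le: "norm T \<le> 2 / c * norm W" using c by (simp add: field_simps)
  have "Sg *v (T - V) = (Sg - S) *v T"
    using T V by (simp add: matrix_vector_mult_diff_distrib matrix_vector_mult_diff_rdistrib)
  then have "c * norm (T - V) \<le> norm ((Sg - S) *v T)"
    using norm_le_of_coercive[OF c coercive, of "T - V"] by simp
  also have "\<dots> \<le> norm (Sg - S) * norm T" by (rule norm_matrix_vector_mult_le)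
  also have "\<dots> \<le> \<delta> * (2 / c * norm W)"
    using close T_le order_trans[OF norm_ge_zero close(1)] by (intro mult_mono) (auto simp: norm_minus_commute)
  finally show ?thesis using c by (simp add: field_simps power2_eq_square)
qed

text \<open>The deterministic core. Suppose that the quadratic criteria are close to \<open>v i + d \<bullet> (Sg *v d)\<close> and that
  \<open>v k\<close> exceeds the other constants. The minimizer \<open>d0\<close> of the \<open>k\<close>-th criterion is close to \<open>0\<close>, hence at
  \<open>d0\<close> the \<open>k\<close>-th criterion is still the largest one. Every other point \<open>d\<close> satisfies
  \<open>max (q i d) \<ge> q k d > q k d0 = max (q i d0)\<close>, so \<open>d0\<close> is the only minimizer of the maximum; it
  solves the normal equation of group \<open>k\<close>.\<close>

lemma minimizer_of_max_of_quadratics: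
  fixes Sg :: "real^'p^'p" and v :: "'i \<Rightarrow> real"
  assumes fin: "finite I" and k: "k \<in> I" and Sg: "positive_definite Sg"
    and gap: "\<And>i. i \<in> I \<Longrightarrow> i \<noteq> k \<Longrightarrow> v i < v k"
  obtains \<delta> where "\<delta> > 0"
    "\<forall>s g S d. (\<forall>i\<in>I. \<bar>s i - v i\<bar> \<le> \<delta> \<and> norm (g i) \<le> \<delta> \<and> norm (S i - Sg) \<le> \<delta>) \<longrightarrow>
       transpose (S k) = S k \<longrightarrow>
       is_arg_min (\<lambda>d. MAX i\<in>I. s i - 2 * (d \<bullet> g i) + d \<bullet> (S i *v d)) (\<lambda>_. True) d \<longrightarrow>
       S k *v d = g k"
proof -
  obtain c where c: "c > 0" "\<And>w. c * (norm w)\<^sup>2 \<le> w \<bullet> (Sg *v w)"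
    using positive_definite_coercive[OF Sg] by blast
  \<comment> \<open>\<open>\<gamma>\<close> is a uniform gap between \<open>v k\<close> and the other constants; the entry \<open>1\<close> covers the case of a
     single group.\<close>
  define \<gamma> where "\<gamma> = Min (insert 1 ((\<lambda>i. v k - v i) ` (I - {k})))"
  have \<gamma>: "\<gamma> > 0" "\<And>i. i \<in> I \<Longrightarrow> i \<noteq> k \<Longrightarrow> v i + \<gamma> \<le> v k"
  proof -
    show "\<gamma> > 0" unfolding \<gamma>_def using fin gap by (subst Min_gr_iff) auto
    fix i assume "i \<in> I" "i \<noteq> k"
    then have "\<gamma> \<le> v k - v i" unfolding \<gamma>_def using fin by (intro Min_le) auto
    then show "v i + \<gamma> \<le> v k" by simp
  qed
  \<comment> \<open>With \<open>norm d0 \<le> 1\<close> and \<open>norm d0 \<le> 2 / c * \<delta>\<close>, the other criteria are at most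
     \<open>v i + 3 * \<delta> + (norm Sg + 1) * (2 / c) * \<delta>\<close> at \<open>d0\<close>, and the \<open>k\<close>-th one is at least
     \<open>v k - 2 * \<delta>\<close>; \<open>C * \<delta>\<close> is the sum of the two errors.\<close>
  define C where "C = 5 + (norm Sg + 1) * (2 / c)"
  have C: "C > 0" using c(1) by (auto simp: C_def intro!: add_pos_nonneg)
  define \<delta> where "\<delta> = Min {1, c / 2, \<gamma> / C}"
  have \<delta>: "\<delta> > 0" "\<delta> \<le> 1" "\<delta> \<le> c / 2" "\<delta> * C \<le> \<gamma>"
  proof -
    show "\<delta> > 0" using c(1) \<gamma>(1) C by (simp add: \<delta>_def)
    show "\<delta> \<le> 1" "\<delta> \<le> c / 2" unfolding \<delta>_def by (rule Min_le; simp)+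
    have "\<delta> \<le> \<gamma> / C" unfolding \<delta>_def by (rule Min_le) simp_all
    then show "\<delta> * C \<le> \<gamma>" using C by (simp add: field_simps)
  qed
  show thesis
  proof (rule that[OF \<delta>(1)], intro allI impI)
    fix s g and S :: "'i \<Rightarrow> real^'p^'p" and d
    let ?q = "\<lambda>i d. s i - 2 * (d \<bullet> g i) + d \<bullet> (S i *v d)"
    assume all_near: "\<forall>i\<in>I. \<bar>s i - v i\<bar> \<le> \<delta> \<and> norm (g i) \<le> \<delta> \<and> norm (S i - Sg) \<le> \<delta>"
      and sym: "transpose (S k) = S k"
      and min: "is_arg_min (\<lambda>d. MAX i\<in>I. ?q i d) (\<lambda>_. True) d"
    have near: "\<bar>s i - v i\<bar> \<le> \<delta> \<and> norm (g i) \<le> \<delta> \<and> norm (S i - Sg) \<le> \<delta>" if "i \<in> I" for i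
      using all_near that by blast
    have coercive: "c / 2 * (norm w)\<^sup>2 \<le> w \<bullet> (S k *v w)" for w
      using near[OF k] \<delta>(3) by (intro coercive_perturbation[OF c(2)]) auto
    obtain d0 where d0: "S k *v d0 = g k"
      using coercive_matrix_solvable[OF _ coercive] c(1) by auto
    have "c / 2 * norm d0 \<le> norm (g k)"
      using norm_le_of_coercive[OF _ coercive, of d0] c(1) d0 by simp
    then have "norm d0 \<le> 2 / c * norm (g k)"
      using c(1) by (simp add: field_simps)
    also have "\<dots> \<le> 2 / c * \<delta>" using near[OF k] c(1) by (intro mult_left_mono) auto
    finally have d0_le: "norm d0 \<le> 2 / c * \<delta>" .
    also have "\<dots> \<le> 1" using \<delta>(3) c(1) by (simp add: field_simps)
    finally have d0_1: "norm d0 \<le> 1" .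
    have d0_g: "\<bar>d0 \<bullet> g i\<bar> \<le> \<delta>" if "i \<in> I" for i
    proof -
      have "\<bar>d0 \<bullet> g i\<bar> \<le> norm d0 * norm (g i)" by (rule Cauchy_Schwarz_ineq2)
      also have "\<dots> \<le> 1 * \<delta>" using d0_1 near[OF that] by (intro mult_mono) auto
      finally show ?thesis by simp
    qed
    have q_expand: "?q k w = ?q k d0 + (w - d0) \<bullet> (S k *v (w - d0))" for w
      using d0 inner_symmetric_matrix[OF sym, of d0 w]
      by (simp add: matrix_vector_mult_diff_distrib inner_diff_left inner_diff_right)
    have dominated: "?q i d0 \<le> ?q k d0" if i: "i \<in> I" for i
    proof (cases "i = k")
      case False
      have "norm (S i) \<le> norm Sg + 1"
        using near[OF i] \<delta>(2) norm_triangle_ineq[of Sg "S i - Sg"] by simp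
      have "d0 \<bullet> (S i *v d0) \<le> norm d0 * (norm (S i) * norm d0)"
        using norm_cauchy_schwarz[of d0 "S i *v d0"] norm_matrix_vector_mult_le[of "S i" d0]
        by (smt (verit) mult_left_mono norm_ge_zero)
      also have "\<dots> \<le> 1 * ((norm Sg + 1) * (2 / c * \<delta>))"
        using d0_1 d0_le \<open>norm (S i) \<le> norm Sg + 1\<close> by (intro mult_mono) auto
      finally have "d0 \<bullet> (S i *v d0) \<le> (norm Sg + 1) * (2 / c) * \<delta>"
        by (simp only: mult.assoc mult_1)
      then have "?q i d0 \<le> v i + 3 * \<delta> + (norm Sg + 1) * (2 / c) * \<delta>"
        using near[OF i] d0_g[OF i] by linarith
      also have "\<dots> = v i + \<delta> * C - 2 * \<delta>" by (simp add: C_def algebra_simps)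
      also have "\<dots> \<le> v k - 2 * \<delta>" using \<delta>(4) \<gamma>(2)[OF i False] by simp
      also have "\<dots> \<le> ?q k d0" using near[OF k] d0_g[OF k] unfolding d0 by linarith
      finally show ?thesis .
    qed simp
    have "(MAX i\<in>I. ?q i d0) = ?q k d0"
      using fin k dominated by (intro Max_eqI) auto
    moreover have "(MAX i\<in>I. ?q i d) \<le> (MAX i\<in>I. ?q i d0)"
      using min unfolding is_arg_min_def by (meson not_le)
    ultimately have "(MAX i\<in>I. ?q i d) \<le> ?q k d0" by simp
    moreover have "?q k d \<le> (MAX i\<in>I. ?q i d)" using fin k by auto
    ultimately have "c / 2 * (norm (d - d0))\<^sup>2 \<le> 0"
      using q_expand[of d] coercive[of "d - d0"] by linarith
    then have "d = d0" using c(1) by (simp add: mult_le_0_iff)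
    then show "S k *v d = g k" using d0 by simp
  qed
qed

section \<open>Characteristic functions in several dimensions\<close>

text \<open>Each approximation below (smoothing, truncation) replaces the integrals by
  ones that converge and are uniformly close for large \<open>n\<close>; this lemma removes the approximation.\<close>

lemma LIMSEQ_approximable:
  fixes f :: "nat \<Rightarrow> 'a::metric_space"
  assumes "\<And>\<epsilon>. \<epsilon> > 0 \<Longrightarrow> \<exists>g c. g \<longlonglongrightarrow> c \<and> (\<forall>\<^sub>F n in sequentially. dist (f n) (g n) \<le> \<epsilon>) \<and> dist l c \<le> \<epsilon>"
  shows "f \<longlonglongrightarrow> l"
proof (rule tendstoI)
  fix \<epsilon> :: real assume "\<epsilon> > 0"
  then obtain g c where g: "g \<longlonglongrightarrow> c" and fg: "\<forall>\<^sub>F n in sequentially. dist (f n) (g n) \<le> \<epsilon> / 4"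
    and lc: "dist l c \<le> \<epsilon> / 4"
    using assms[of "\<epsilon> / 4"] by auto
  have "\<forall>\<^sub>F n in sequentially. dist (g n) c < \<epsilon> / 4"
    using g \<open>\<epsilon> > 0\<close> by (intro tendstoD) auto
  with fg show "\<forall>\<^sub>F n in sequentially. dist (f n) l < \<epsilon>"
  proof eventually_elim
    case (elim n)
    have "dist (f n) l \<le> dist (f n) (g n) + (dist (g n) c + dist c l)"
      using dist_triangle[of "f n" l "g n"] dist_triangle[of "g n" l c] by linarith
    then show ?case using elim lc \<open>\<epsilon> > 0\<close> by (simp add: dist_commute)
  qed
qed

definition char_vec :: "(real^'p) measure \<Rightarrow> real^'p \<Rightarrow> complex" where
  "char_vec \<mu> t = (CLINT v|\<mu>. iexp (t \<bullet> v))"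

lemma prod_components_eq_prod_Basis:
  fixes F :: "'p::finite \<Rightarrow> real \<Rightarrow> 'b::comm_monoid_mult" and z :: "real^'p"
  shows "(\<Prod>a\<in>UNIV. F a (z $ a)) = (\<Prod>b\<in>Basis. F (axis_index b) (z \<bullet> b))"
proof -
  have "(\<Prod>b\<in>Basis. F (axis_index b) (z \<bullet> b)) =
        (\<Prod>b\<in>(\<lambda>a. axis a (1::real)) ` (UNIV :: 'p set). F (axis_index b) (z \<bullet> b))"
    by (intro prod.cong) (auto simp: Basis_vec_def)
  also have "\<dots> = (\<Prod>a\<in>UNIV. F a (z $ a))"
    by (subst prod.reindex) (auto simp: inj_on_def axis_eq_axis inner_axis axis_index_axis)
  finally show ?thesis ..
qed

lemma std_normal_vec_density:
  "(\<Prod>a\<in>UNIV. std_normal_density (z $ a)) = (1 / sqrt (2 * pi)) ^ CARD('p) * exp (- (norm z)\<^sup>2 / 2)"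
  for z :: "real^'p"
proof -
  have "(\<Prod>a\<in>UNIV. std_normal_density (z $ a)) =
        (1 / sqrt (2 * pi)) ^ CARD('p) * exp (\<Sum>a\<in>UNIV. - (z $ a)\<^sup>2 / 2)"
    by (simp add: normal_density_def prod.distrib exp_sum prod_dividef power_divide)
  also have "(\<Sum>a\<in>UNIV. - (z $ a)\<^sup>2 / 2) = - (norm z)\<^sup>2 / 2"
    by (simp add: norm_vec_def L2_set_def sum_nonneg sum_negf flip: sum_divide_distrib)
  finally show ?thesis .
qed

lemma prob_space_std_normal_vec: "prob_space (std_normal_vec :: (real^'p) measure)"
proof
  have "emeasure (std_normal_vec :: (real^'p) measure) (space std_normal_vec) =
        (\<integral>\<^sup>+ z. ennreal (\<Prod>a\<in>UNIV. std_normal_density (z $ a)) \<partial>(lborel :: (real^'p) measure))"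
    by (simp add: std_normal_vec_def emeasure_density)
  also have "\<dots> = (\<integral>\<^sup>+ z. (\<Prod>b\<in>Basis. ennreal (std_normal_density (z \<bullet> b))) \<partial>(lborel :: (real^'p) measure))"
    by (subst prod_components_eq_prod_Basis) (simp add: prod_ennreal)
  also have "\<dots> = (\<Prod>b\<in>(Basis :: (real^'p) set). \<integral>\<^sup>+ x. ennreal (std_normal_density x) \<partial>lborel)"
    by (rule nn_integral_lborel_prod) auto
  also have "(\<integral>\<^sup>+ x. ennreal (std_normal_density x) \<partial>lborel) = 1"
    using prob_space.emeasure_space_1[OF prob_space_normal_density[of 1 0]]
    by (simp add: emeasure_density)
  finally show "emeasure (std_normal_vec :: (real^'p) measure) (space std_normal_vec) = 1" by simp
qed

lemma sets_std_normal_vec [simp, measurable_cong]: "sets std_normal_vec = sets borel"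
  and space_std_normal_vec [simp]: "space std_normal_vec = UNIV"
  by (simp_all add: std_normal_vec_def)

text \<open>Fubini reduces the integral to a product of characteristic functions of the one-dimensional standard
  normal distribution.\<close>

lemma char_vec_std_normal:
  "char_vec std_normal_vec t = complex_of_real (exp (- (norm t)\<^sup>2 / 2))" for t :: "real^'p"
proof -
  interpret product_sigma_finite "\<lambda>_::real^'p. lborel :: real measure" ..
  let ?h = "\<lambda>b x. std_normal_density x *\<^sub>R iexp ((t \<bullet> b) * x)"
  have h: "integrable lborel (?h b)"
    "integral\<^sup>L lborel (?h b) = complex_of_real (exp (- (t \<bullet> b)\<^sup>2 / 2))" for b :: "real^'p"
  proof -
    have "integrable std_normal_distribution (\<lambda>x. iexp ((t \<bullet> b) * x))"
      using prob_space.integrable_iexp[OF real_distribution.axioms(1)[OF real_dist_normal_dist],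
          of "\<lambda>x. complex_of_real ((t \<bullet> b) * x)"] by simp
    then show "integrable lborel (?h b)"
      by (subst (asm) integrable_density) auto
    have "char std_normal_distribution (t \<bullet> b) = integral\<^sup>L lborel (?h b)"
      unfolding char_def by (subst integral_density) auto
    then show "integral\<^sup>L lborel (?h b) = complex_of_real (exp (- (t \<bullet> b)\<^sup>2 / 2))"
      by (simp add: char_std_normal_distribution)
  qed
  have split: "(\<Prod>b\<in>Basis. ?h b (z \<bullet> b)) = (\<Prod>a\<in>UNIV. std_normal_density (z $ a)) *\<^sub>R iexp (t \<bullet> z)"
    for z :: "real^'p"
  proof -
    have "iexp (t \<bullet> z) = (\<Prod>b\<in>Basis. iexp ((t \<bullet> b) * (z \<bullet> b)))"
      by (subst euclidean_inner) (simp add: sum_distrib_left exp_sum)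
    moreover have "(\<Prod>a\<in>UNIV. std_normal_density (z $ a)) = (\<Prod>b\<in>Basis. std_normal_density (z \<bullet> b))"
      by (rule prod_components_eq_prod_Basis)
    ultimately show ?thesis by (simp add: scaleR_conv_of_real prod.distrib)
  qed
  have "char_vec std_normal_vec t = (CLINT z|lborel. (\<Prod>a\<in>UNIV. std_normal_density (z $ a)) *\<^sub>R iexp (t \<bullet> z))"
    unfolding char_vec_def std_normal_vec_def
    by (subst integral_density) (auto intro!: prod_nonneg)
  also have "\<dots> = (CLINT z|lborel. (\<Prod>b\<in>Basis. ?h b (z \<bullet> b)))"
    by (simp only: split)
  also have "\<dots> = (CLINT f|(\<Pi>\<^sub>M b\<in>Basis. lborel). (\<Prod>b\<in>Basis. ?h b (f b)))"
    by (subst lborel_eq, subst integral_distr) (auto intro!: Bochner_Integration.integral_cong prod.cong)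
  also have "\<dots> = (\<Prod>b\<in>Basis. integral\<^sup>L lborel (?h b))"
    by (rule product_integral_prod) (use h in auto)
  also have "\<dots> = (\<Prod>b\<in>Basis. complex_of_real (exp (- (t \<bullet> b)\<^sup>2 / 2)))"
    by (simp only: h)
  also have "\<dots> = complex_of_real (exp (\<Sum>b\<in>Basis. - (t \<bullet> b)\<^sup>2 / 2))"
    by (simp add: exp_sum)
  also have "(\<Sum>b\<in>Basis. - (t \<bullet> b)\<^sup>2 / 2) = - (norm t)\<^sup>2 / 2"
    unfolding power2_norm_eq_inner
    by (subst euclidean_inner[of t t]) (simp add: power2_eq_square sum_negf flip: sum_divide_distrib)
  finally show ?thesis .
qed

lemma small_tail:
  fixes \<mu> :: "(real^'p) measure"
  assumes "prob_space \<mu>" and [measurable_cong]: "sets \<mu> = sets borel" and "\<epsilon> > 0"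
  obtains R where "R > 0" "measure \<mu> {v. R < norm v} < \<epsilon>"
proof -
  interpret prob_space \<mu> by fact
  have sp: "space \<mu> = UNIV" using sets_eq_imp_space_eq[OF assms(2)] by simp
  have "(\<lambda>n. prob {v. real n < norm v}) \<longlonglongrightarrow> prob (\<Inter>n. {v. real n < norm v})"
  proof (rule finite_Lim_measure_decseq)
    have "{v \<in> space \<mu>. real n < norm v} \<in> events" for n by measurable
    then show "range (\<lambda>n. {v. real n < norm v}) \<subseteq> events" by (auto simp: sp)
  qed (auto simp: decseq_def)
  also have "(\<Inter>n. {v::real^'p. real n < norm v}) = {}"
    using less_asym reals_Archimedean2 by fastforce
  finally have "\<forall>\<^sub>F n in sequentially. prob {v. real n < norm v} < \<epsilon>"
    using \<open>\<epsilon> > 0\<close> by (intro order_tendstoD) auto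
  then have "\<forall>\<^sub>F n in sequentially. 0 < n \<and> prob {v. real n < norm v} < \<epsilon>"
    using eventually_gt_at_top[of "0::nat"] by eventually_elim auto
  then obtain n where "0 < n" "prob {v. real n < norm v} < \<epsilon>"
    by (auto simp: eventually_sequentially)
  then show thesis by (intro that[of "real n"]) auto
qed

text \<open>The Gaussian kernel is, up to a constant, its own Fourier transform. Writing it as a characteristic
  functional and exchanging the integrals turns the integral of the kernel against \<open>\<mu>\<close> into an integral
  of \<open>char_vec \<mu>\<close>: the substitute for Fourier inversion.\<close>

lemma gaussian_kernel_integral_eq:
  fixes \<mu> :: "(real^'p) measure"
  assumes "prob_space \<mu>" and s: "sets \<mu> = sets borel"
  shows "complex_of_real (\<integral>v. exp (- (norm (c *\<^sub>R (y - v)))\<^sup>2 / 2) \<partial>\<mu>) =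
         (CLINT z|std_normal_vec. iexp ((c *\<^sub>R y) \<bullet> z) * char_vec \<mu> (- (c *\<^sub>R z)))"
proof -
  note [measurable_cong] = s
  interpret \<mu>: prob_space \<mu> by fact
  interpret N: prob_space "std_normal_vec :: (real^'p) measure" by (rule prob_space_std_normal_vec)
  interpret P: pair_prob_space \<mu> "std_normal_vec :: (real^'p) measure" ..
  let ?k = "\<lambda>v z. iexp ((c *\<^sub>R (y - v)) \<bullet> z)"
  have "complex_of_real (\<integral>v. exp (- (norm (c *\<^sub>R (y - v)))\<^sup>2 / 2) \<partial>\<mu>) =
        (CLINT v|\<mu>. char_vec std_normal_vec (c *\<^sub>R (y - v)))"
    by (simp only: char_vec_std_normal integral_complex_of_real)
  also have "\<dots> = (CLINT v|\<mu>. CLINT z|std_normal_vec. ?k v z)"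
    by (simp add: char_vec_def)
  also have "\<dots> = (CLINT z|std_normal_vec. CLINT v|\<mu>. ?k v z)"
  proof (rule P.Fubini_integral[symmetric])
    show "integrable (\<mu> \<Otimes>\<^sub>M std_normal_vec) (\<lambda>(v, z). ?k v z)"
      by (rule P.integrable_const_bound[where B = 1]) (auto simp: split_beta)
  qed
  also have "\<dots> = (CLINT z|std_normal_vec. iexp ((c *\<^sub>R y) \<bullet> z) * char_vec \<mu> (- (c *\<^sub>R z)))"
  proof (rule Bochner_Integration.integral_cong[OF refl])
    fix z :: "real^'p"
    have "?k v z = iexp ((c *\<^sub>R y) \<bullet> z) * iexp (- (c *\<^sub>R z) \<bullet> v)" for v
      by (simp add: inner_diff_left inner_commute algebra_simps flip: exp_add)
    then show "(CLINT v|\<mu>. ?k v z) = iexp ((c *\<^sub>R y) \<bullet> z) * char_vec \<mu> (- (c *\<^sub>R z))"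
      by (simp add: char_vec_def)
  qed
  finally show ?thesis .
qed

lemma norm_char_vec_le_1:
  assumes "prob_space \<mu>"
  shows "norm (char_vec \<mu> t) \<le> 1"
proof -
  interpret prob_space \<mu> by fact
  have "norm (char_vec \<mu> t) \<le> (\<integral>v. norm (iexp (t \<bullet> v)) \<partial>\<mu>)"
    unfolding char_vec_def by (rule integral_norm_bound)
  then show ?thesis by (simp add: prob_space)
qed

lemma borel_measurable_char_vec:
  assumes "prob_space \<mu>" "sets \<mu> = sets borel"
  shows "char_vec \<mu> \<in> borel_measurable borel"
proof -
  note [measurable_cong] = assms(2)
  interpret prob_space \<mu> by fact
  show ?thesis unfolding char_vec_def by measurable
qed

lemma gaussian_kernel_converges:
  fixes \<mu> :: "nat \<Rightarrow> (real^'p) measure"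
  assumes \<mu>: "\<And>n. prob_space (\<mu> n)" "\<And>n. sets (\<mu> n) = sets borel"
    and L: "prob_space L" "sets L = sets borel"
    and conv: "\<And>t. (\<lambda>n. char_vec (\<mu> n) t) \<longlonglongrightarrow> char_vec L t"
  shows "(\<lambda>n. \<integral>v. exp (- (norm (c *\<^sub>R (y - v)))\<^sup>2 / 2) \<partial>\<mu> n)
          \<longlonglongrightarrow> (\<integral>v. exp (- (norm (c *\<^sub>R (y - v)))\<^sup>2 / 2) \<partial>L)"
proof -
  interpret N: prob_space "std_normal_vec :: (real^'p) measure" by (rule prob_space_std_normal_vec)
  note [measurable] = borel_measurable_char_vec[OF \<mu>] borel_measurable_char_vec[OF L]
  have "(\<lambda>n. CLINT z|std_normal_vec. iexp ((c *\<^sub>R y) \<bullet> z) * char_vec (\<mu> n) (- (c *\<^sub>R z)))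
     \<longlonglongrightarrow> (CLINT z|std_normal_vec. iexp ((c *\<^sub>R y) \<bullet> z) * char_vec L (- (c *\<^sub>R z)))"
    by (rule integral_dominated_convergence[where w = "\<lambda>_. 1"])
       (auto intro!: tendsto_mult_left conv norm_char_vec_le_1 \<mu> simp: norm_mult)
  then show ?thesis
    by (simp only: gaussian_kernel_integral_eq[OF \<mu>, symmetric]
        gaussian_kernel_integral_eq[OF L, symmetric] tendsto_of_real_iff)
qed

text \<open>The substitution \<open>y = v + h z\<close> moves the dependence on \<open>v\<close> from \<open>f\<close> into the kernel.\<close>

lemma gaussian_average_as_kernel_integral:
  fixes f :: "real^'p \<Rightarrow> real"
  assumes [measurable]: "f \<in> borel_measurable borel" and h: "h > 0"
  shows "(\<integral>z. f (v + h *\<^sub>R z) \<partial>std_normal_vec) =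
         (1 / h) ^ CARD('p) * (1 / sqrt (2 * pi)) ^ CARD('p) *
         (\<integral>y. f y * exp (- (norm ((1 / h) *\<^sub>R (y - v)))\<^sup>2 / 2) \<partial>lborel)"
proof -
  let ?\<kappa> = "(1 / sqrt (2 * pi)) ^ CARD('p)"
  let ?E = "\<lambda>z::real^'p. exp (- (norm z)\<^sup>2 / 2)"
  have "(\<integral>z. f (v + h *\<^sub>R z) \<partial>std_normal_vec) = (\<integral>z. ?\<kappa> * ?E z * f (v + h *\<^sub>R z) \<partial>lborel)"
    unfolding std_normal_vec_def std_normal_vec_density by (subst integral_density) auto
  also have "\<dots> = ?\<kappa> * (\<integral>z. ?E z * f (v + h *\<^sub>R z) \<partial>lborel)"
    by (simp only: mult.assoc integral_mult_right_zero)
  also have "(\<integral>z. ?E z * f (v + h *\<^sub>R z) \<partial>lborel) =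
    (1 / h) ^ CARD('p) * (\<integral>y. f y * ?E ((1 / h) *\<^sub>R (y - v)) \<partial>lborel)"
  proof -
    have "(\<integral>y. f y * ?E ((1 / h) *\<^sub>R (y - v)) \<partial>lborel) =
       (\<integral>y. f y * ?E ((1 / h) *\<^sub>R (y - v)) \<partial>density (distr lborel borel (\<lambda>x. v + h *\<^sub>R x)) (\<lambda>_. \<bar>h\<bar>^DIM(real^'p)))"
      using h by (subst lborel_affine[of h v]) auto
    also have "\<dots> = h ^ CARD('p) * (\<integral>z. f (v + h *\<^sub>R z) * ?E z \<partial>lborel)"
      using h by (subst integral_density) (auto simp: integral_distr)
    finally show ?thesis using h by (simp add: mult.commute power_one_over)
  qed
  finally show ?thesis by simp
qed

text \<open>After Fubini the laws enter only through the integrals of the Gaussian kernel, which converge for every \<open>y\<close> and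
  are bounded by \<open>1\<close>, so \<open>norm (f y)\<close> is a dominating function.\<close>

lemma gaussian_average_converges:
  fixes \<mu> :: "nat \<Rightarrow> (real^'p) measure" and f :: "real^'p \<Rightarrow> real"
  assumes \<mu>: "\<And>n. prob_space (\<mu> n)" "\<And>n. sets (\<mu> n) = sets borel"
    and L: "prob_space L" "sets L = sets borel"
    and conv: "\<And>t. (\<lambda>n. char_vec (\<mu> n) t) \<longlonglongrightarrow> char_vec L t"
    and f: "integrable lborel f" and h: "h > 0"
  shows "(\<lambda>n. \<integral>v. (\<integral>z. f (v + h *\<^sub>R z) \<partial>std_normal_vec) \<partial>\<mu> n)
          \<longlonglongrightarrow> (\<integral>v. (\<integral>z. f (v + h *\<^sub>R z) \<partial>std_normal_vec) \<partial>L)"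
proof -
  have [measurable]: "f \<in> borel_measurable borel" using f by auto
  let ?K = "\<lambda>y v::real^'p. exp (- (norm ((1 / h) *\<^sub>R (y - v)))\<^sup>2 / 2)"
  let ?c = "(1 / h) ^ CARD('p) * (1 / sqrt (2 * pi)) ^ CARD('p)"
  have swap: "(\<integral>v. (\<integral>z. f (v + h *\<^sub>R z) \<partial>std_normal_vec) \<partial>\<nu>) = ?c * (\<integral>y. f y * (\<integral>v. ?K y v \<partial>\<nu>) \<partial>lborel)"
    if \<nu>: "prob_space \<nu>" "sets \<nu> = sets borel" for \<nu>
  proof -
    note [measurable_cong] = \<nu>(2)
    interpret \<nu>: prob_space \<nu> by fact
    interpret P: pair_sigma_finite \<nu> "lborel :: (real^'p) measure" ..
    have "integrable (\<nu> \<Otimes>\<^sub>M lborel) (\<lambda>(v, y). f y * ?K y v)"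
    proof (rule P.Fubini_integrable)
      have "norm (\<integral>y. norm (f y * ?K y v) \<partial>lborel) \<le> (\<integral>y. norm (f y) \<partial>lborel)" for v
        unfolding real_norm_def
        by (subst abs_of_nonneg, simp, rule integral_mono')
           (use f in \<open>auto simp: abs_mult intro!: mult_left_le\<close>)
      then show "integrable \<nu> (\<lambda>v. \<integral>y. norm (case (v, y) of (v, y) \<Rightarrow> f y * ?K y v) \<partial>lborel)"
        by (intro \<nu>.integrable_const_bound[where B = "\<integral>y. norm (f y) \<partial>lborel"]) auto
      have "integrable lborel (\<lambda>y. f y * ?K y v)" for v
        by (rule Bochner_Integration.integrable_bound[OF f]) (auto simp: abs_mult intro!: mult_left_le)
      then show "AE v in \<nu>. integrable lborel (\<lambda>y. case (v, y) of (v, y) \<Rightarrow> f y * ?K y v)"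
        by simp
    qed simp
    then have "(\<integral>v. (\<integral>y. f y * ?K y v \<partial>lborel) \<partial>\<nu>) = (\<integral>y. (\<integral>v. f y * ?K y v \<partial>\<nu>) \<partial>lborel)"
      by (rule P.Fubini_integral[symmetric])
    then show ?thesis
      by (simp add: gaussian_average_as_kernel_integral[OF _ h])
  qed
  have "(\<lambda>n. \<integral>y. f y * (\<integral>v. ?K y v \<partial>\<mu> n) \<partial>lborel) \<longlonglongrightarrow> (\<integral>y. f y * (\<integral>v. ?K y v \<partial>L) \<partial>lborel)"
  proof (rule integral_dominated_convergence[where w = "\<lambda>y. norm (f y)"])
    have m: "(\<lambda>y. \<integral>v. ?K y v \<partial>\<nu>) \<in> borel_measurable borel" if "prob_space \<nu>" "sets \<nu> = sets borel" for \<nu>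
    proof -
      interpret prob_space \<nu> by fact
      note [measurable_cong] = that(2)
      show ?thesis by measurable
    qed
    note [measurable] = m[OF \<mu>] m[OF L]
    show "(\<lambda>y. f y * (\<integral>v. ?K y v \<partial>L)) \<in> borel_measurable lborel"
      "\<And>n. (\<lambda>y. f y * (\<integral>v. ?K y v \<partial>\<mu> n)) \<in> borel_measurable lborel"
      by measurable
    show "integrable lborel (\<lambda>y. norm (f y))" using f by simp
    show "AE y in lborel. (\<lambda>n. f y * (\<integral>v. ?K y v \<partial>\<mu> n)) \<longlonglongrightarrow> f y * (\<integral>v. ?K y v \<partial>L)"
      by (intro AE_I2 tendsto_mult_left gaussian_kernel_converges \<mu> L conv)
    fix n
    interpret prob_space "\<mu> n" by (rule \<mu>)
    note [measurable_cong] = \<mu>(2)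
    have "(\<integral>v. ?K y v \<partial>\<mu> n) \<le> (\<integral>v. 1 \<partial>\<mu> n)" for y
      by (rule integral_mono') auto
    then have "\<bar>\<integral>v. ?K y v \<partial>\<mu> n\<bar> \<le> 1" for y
      by (simp add: prob_space)
    then show "AE y in lborel. norm (f y * (\<integral>v. ?K y v \<partial>\<mu> n)) \<le> norm (f y)"
      by (auto simp: abs_mult intro!: mult_left_le)
  qed
  then show ?thesis
    unfolding swap[OF \<mu>] swap[OF L] by (rule tendsto_mult_left)
qed

lemma compactly_supported_bounded:
  fixes f :: "real^'p \<Rightarrow> real"
  assumes f: "continuous_on UNIV f" and supp: "\<And>v. norm v > R \<Longrightarrow> f v = 0"
  obtains B where "B > 0" "\<And>v. \<bar>f v\<bar> \<le> B"
proof -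
  have "compact (f ` cball 0 R)"
    by (intro compact_continuous_image continuous_on_subset[OF f]) auto
  then obtain B0 where "\<And>v. v \<in> cball 0 R \<Longrightarrow> \<bar>f v\<bar> \<le> B0"
    using compact_imp_bounded by (fastforce simp: bounded_iff)
  then have B: "\<bar>f v\<bar> \<le> max 1 B0" for v
    using supp[of v] by (cases "norm v \<le> R") (auto simp: le_max_iff_disj)
  then show thesis by (intro that[of "max 1 B0"]) auto
qed

text \<open>A continuous function of compact support is uniformly continuous, so averaging it over a small Gaussian
  neighbourhood changes it little, except when the Gaussian vector is large, which has small
  probability.\<close>

lemma gaussian_average_uniformly_close:
  fixes f :: "real^'p \<Rightarrow> real"
  assumes f: "continuous_on UNIV f" and supp: "\<And>v. norm v > R \<Longrightarrow> f v = 0" and "\<epsilon> > 0"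
  obtains h where "h > 0" "\<And>v. \<bar>(\<integral>z. f (v + h *\<^sub>R z) \<partial>std_normal_vec) - f v\<bar> \<le> \<epsilon>"
proof -
  interpret N: prob_space "std_normal_vec :: (real^'p) measure" by (rule prob_space_std_normal_vec)
  have [measurable]: "f \<in> borel_measurable borel"
    using f by (rule borel_measurable_continuous_onI)
  obtain B where B: "B > 0" "\<And>v. \<bar>f v\<bar> \<le> B"
    using compactly_supported_bounded[OF f supp] by blast
  have "uniformly_continuous_on (cball 0 (R + 1)) f"
    by (intro compact_uniformly_continuous continuous_on_subset[OF f]) auto
  then obtain d where d: "d > 0"
    "\<And>v w. v \<in> cball 0 (R + 1) \<Longrightarrow> w \<in> cball 0 (R + 1) \<Longrightarrow> dist w v < d \<Longrightarrow> dist (f w) (f v) < \<epsilon> / 2"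
    using \<open>\<epsilon> > 0\<close> unfolding uniformly_continuous_on_def by (metis half_gt_zero)
  \<comment> \<open>The radius \<open>R + 1\<close> and \<open>d' < 1\<close> ensure that two points at distance at most \<open>d'\<close> which are not both
     in the larger ball are both outside the support.\<close>
  define d' where "d' = min d 1 / 2"
  have d': "0 < d'" "d' < d" "d' < 1" using d(1) by (auto simp: d'_def min_def)
  have close: "\<bar>f (v + w) - f v\<bar> \<le> \<epsilon> / 2" if "norm w \<le> d'" for v w
  proof (cases "norm v \<le> R + 1 \<and> norm (v + w) \<le> R + 1")
    case True
    then have "v \<in> cball 0 (R + 1)" "v + w \<in> cball 0 (R + 1)" by (simp_all only: mem_cball_0)
    moreover have "dist (v + w) v < d" using that d' by (simp add: dist_norm)
    ultimately have "dist (f (v + w)) (f v) < \<epsilon> / 2" by (rule d(2))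
    then show ?thesis by (simp add: dist_real_def)
  next
    case False
    then have "norm v > R" "norm (v + w) > R"
      using that d' norm_triangle_ineq[of v w] norm_triangle_ineq4[of "v + w" w] by auto
    then show ?thesis using supp \<open>\<epsilon> > 0\<close> by simp
  qed
  obtain Q where Q: "Q > 0" "N.prob {z. Q < norm z} < \<epsilon> / (4 * B)"
    using small_tail[OF prob_space_std_normal_vec sets_std_normal_vec, of "\<epsilon> / (4 * B)"] \<open>\<epsilon> > 0\<close> B(1) by auto
  have [measurable]: "{z::real^'p. Q < norm z} \<in> sets borel"
  proof -
    have "{z \<in> space borel. Q < norm (z::real^'p)} \<in> sets borel" by measurable
    then show ?thesis by simp
  qed
  define h where "h = d' / Q"
  have h: "h > 0" using d' Q by (simp add: h_def)
  show thesis
  proof (rule that[OF h])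
    fix v
    have int: "integrable std_normal_vec (\<lambda>z. f (v + h *\<^sub>R z))"
      by (rule N.integrable_const_bound[where B = B]) (auto simp: B)
    have "\<bar>(\<integral>z. f (v + h *\<^sub>R z) \<partial>std_normal_vec) - f v\<bar> = \<bar>\<integral>z. f (v + h *\<^sub>R z) - f v \<partial>std_normal_vec\<bar>"
      using int by (simp add: N.prob_space[simplified])
    also have "\<dots> \<le> (\<integral>z. \<bar>f (v + h *\<^sub>R z) - f v\<bar> \<partial>std_normal_vec)"
      by (rule integral_abs_bound)
    also have "\<dots> \<le> (\<integral>z. \<epsilon> / 2 + 2 * B * indicator {z. Q < norm z} (z :: real^'p) \<partial>std_normal_vec)"
    proof (rule integral_mono)
      show "integrable std_normal_vec (\<lambda>z. \<bar>f (v + h *\<^sub>R z) - f v\<bar>)" using int by simp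
      show "integrable std_normal_vec (\<lambda>z :: real^'p. \<epsilon> / 2 + 2 * B * indicator {z. Q < norm z} z)"
        by (intro Bochner_Integration.integrable_add N.integrable_const integrable_mult_right
            integrable_real_indicator) (auto simp: N.emeasure_eq_measure)
      fix z :: "real^'p"
      show "\<bar>f (v + h *\<^sub>R z) - f v\<bar> \<le> \<epsilon> / 2 + 2 * B * indicator {z. Q < norm z} z"
      proof (cases "Q < norm z")
        case True
        then show ?thesis using B(2)[of v] B(2)[of "v + h *\<^sub>R z"] \<open>\<epsilon> > 0\<close> by simp
      next
        case False
        then have "norm (h *\<^sub>R z) \<le> d'" using Q d' by (simp add: h_def field_simps)
        then show ?thesis using close[of "h *\<^sub>R z" v] False by simp
      qed
    qed
    also have "\<dots> = \<epsilon> / 2 + 2 * B * N.prob {z. Q < norm z}"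
      by (subst Bochner_Integration.integral_add) (auto simp: N.emeasure_eq_measure N.prob_space[simplified])
    also have "\<dots> \<le> \<epsilon>" using Q B(1) by (simp add: field_simps)
    finally show "\<bar>(\<integral>z. f (v + h *\<^sub>R z) \<partial>std_normal_vec) - f v\<bar> \<le> \<epsilon>" .
  qed
qed

lemma compactly_supported_integral_converges:
  fixes \<mu> :: "nat \<Rightarrow> (real^'p) measure" and f :: "real^'p \<Rightarrow> real"
  assumes \<mu>: "\<And>n. prob_space (\<mu> n)" "\<And>n. sets (\<mu> n) = sets borel"
    and L: "prob_space L" "sets L = sets borel"
    and conv: "\<And>t. (\<lambda>n. char_vec (\<mu> n) t) \<longlonglongrightarrow> char_vec L t"
    and f: "continuous_on UNIV f" and supp: "\<And>v. norm v > R \<Longrightarrow> f v = 0"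
  shows "(\<lambda>n. \<integral>v. f v \<partial>\<mu> n) \<longlonglongrightarrow> (\<integral>v. f v \<partial>L)"
proof (rule LIMSEQ_approximable)
  fix \<epsilon> :: real assume "\<epsilon> > 0"
  have [measurable]: "f \<in> borel_measurable borel"
    using f by (rule borel_measurable_continuous_onI)
  obtain B where B: "B > 0" "\<And>v. \<bar>f v\<bar> \<le> B"
    using compactly_supported_bounded[OF f supp] by blast
  have "integrable lborel (\<lambda>v. indicator (cball 0 R) v *\<^sub>R f v)"
    by (intro borel_integrable_compact continuous_on_subset[OF f]) auto
  also have "(\<lambda>v. indicator (cball 0 R) v *\<^sub>R f v) = f"
    using supp by (auto simp: fun_eq_iff indicator_def not_le)
  finally have f_int: "integrable lborel f" .
  obtain h where h: "h > 0" "\<And>v. \<bar>(\<integral>z. f (v + h *\<^sub>R z) \<partial>std_normal_vec) - f v\<bar> \<le> \<epsilon>"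
    using gaussian_average_uniformly_close[OF f supp \<open>\<epsilon> > 0\<close>] by blast
  let ?g = "\<lambda>v. \<integral>z. f (v + h *\<^sub>R z) \<partial>std_normal_vec"
  interpret N: prob_space "std_normal_vec :: (real^'p) measure" by (rule prob_space_std_normal_vec)
  have close: "dist (\<integral>v. f v \<partial>\<nu>) (\<integral>v. ?g v \<partial>\<nu>) \<le> \<epsilon>"
    if \<nu>: "prob_space \<nu>" "sets \<nu> = sets borel" for \<nu>
  proof -
    note [measurable_cong] = \<nu>(2)
    interpret prob_space \<nu> by fact
    have f_\<nu>: "integrable \<nu> f" by (rule integrable_const_bound[where B = "B"]) (auto simp: B)
    have "\<bar>?g v\<bar> \<le> B + \<epsilon>" for v using h(2)[of v] B(2)[of v] by linarith
    then have g_\<nu>: "integrable \<nu> ?g" by (intro integrable_const_bound[where B = "B + \<epsilon>"]) auto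
    have "\<bar>(\<integral>v. f v \<partial>\<nu>) - (\<integral>v. ?g v \<partial>\<nu>)\<bar> = \<bar>\<integral>v. f v - ?g v \<partial>\<nu>\<bar>"
      using f_\<nu> g_\<nu> by simp
    also have "\<dots> \<le> (\<integral>v. \<bar>f v - ?g v\<bar> \<partial>\<nu>)" by (rule integral_abs_bound)
    also have "\<dots> \<le> (\<integral>v. \<epsilon> \<partial>\<nu>)"
      using f_\<nu> g_\<nu> h(2) by (intro integral_mono) (auto simp: abs_minus_commute)
    finally show ?thesis by (simp add: dist_real_def prob_space)
  qed
  show "\<exists>g c. g \<longlonglongrightarrow> c \<and> (\<forall>\<^sub>F n in sequentially. dist (\<integral>v. f v \<partial>\<mu> n) (g n) \<le> \<epsilon>) \<and> dist (\<integral>v. f v \<partial>L) c \<le> \<epsilon>"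
    using gaussian_average_converges[OF \<mu> L conv f_int h(1)] close[OF \<mu>] close[OF L]
    by (intro exI[of _ "\<lambda>n. \<integral>v. ?g v \<partial>\<mu> n"] exI[of _ "\<integral>v. ?g v \<partial>L"]) auto
qed

text \<open>The several-dimensional counterpart of \<open>levy_continuity\<close>. For compactly supported \<open>f\<close> the smoothing argument
  applies. In general \<open>f\<close> is multiplied by a cutoff \<open>\<psi>\<close>; since \<open>\<psi>\<close> itself is compactly supported,
  the integrals of \<open>1 - \<psi>\<close>, which bound the error of this truncation, converge to the integral with respect to \<open>L\<close>,
  and this is small. Tightness is thus a consequence of the convergence for compactly supported functions.\<close>

lemma levy_continuity_vec:
  fixes \<mu> :: "nat \<Rightarrow> (real^'p) measure" and f :: "real^'p \<Rightarrow> real"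
  assumes \<mu>: "\<And>n. prob_space (\<mu> n)" "\<And>n. sets (\<mu> n) = sets borel"
    and L: "prob_space L" "sets L = sets borel"
    and conv: "\<And>t. (\<lambda>n. char_vec (\<mu> n) t) \<longlonglongrightarrow> char_vec L t"
    and f: "continuous_on UNIV f" and bdd: "bounded (range f)"
  shows "(\<lambda>n. \<integral>v. f v \<partial>\<mu> n) \<longlonglongrightarrow> (\<integral>v. f v \<partial>L)"
proof (rule LIMSEQ_approximable)
  fix \<epsilon> :: real assume "\<epsilon> > 0"
  have f_meas [measurable]: "f \<in> borel_measurable borel"
    using f by (rule borel_measurable_continuous_onI)
  obtain B where B: "B > 0" "\<And>v. \<bar>f v\<bar> \<le> B"
    using bdd by (auto simp: bounded_pos)
  obtain R where R: "R > 0" "measure L {v. R < norm v} < \<epsilon> / (2 * B)"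
    using small_tail[OF L, of "\<epsilon> / (2 * B)"] \<open>\<epsilon> > 0\<close> B(1) by auto
  define \<psi> :: "real^'p \<Rightarrow> real" where "\<psi> v = max 0 (min 1 (R + 1 - norm v))" for v
  have \<psi>: "0 \<le> \<psi> v" "\<psi> v \<le> 1" for v by (auto simp: \<psi>_def)
  have cont: "continuous_on UNIV \<psi>" unfolding \<psi>_def by (intro continuous_intros)
  then have [measurable]: "\<psi> \<in> borel_measurable borel" by (rule borel_measurable_continuous_onI)
  have supp: "\<psi> v = 0" if "norm v > R + 1" for v using that by (simp add: \<psi>_def)
  have close: "dist (\<integral>v. f v \<partial>\<nu>) (\<integral>v. f v * \<psi> v \<partial>\<nu>) \<le> B * (1 - (\<integral>v. \<psi> v \<partial>\<nu>))"
    if \<nu>: "prob_space \<nu>" "sets \<nu> = sets borel" for \<nu>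
  proof -
    note [measurable_cong] = \<nu>(2)
    interpret prob_space \<nu> by fact
    have f_\<nu>: "integrable \<nu> f" by (rule integrable_const_bound[where B = B]) (auto simp: B)
    have \<psi>_\<nu>: "integrable \<nu> \<psi>" by (rule integrable_const_bound[where B = 1]) (auto simp: \<psi>)
    have f\<psi>_\<nu>: "integrable \<nu> (\<lambda>v. f v * \<psi> v)"
      by (rule Bochner_Integration.integrable_bound[OF f_\<nu>]) (auto simp: abs_mult \<psi> intro!: mult_left_le)
    have "\<bar>(\<integral>v. f v \<partial>\<nu>) - (\<integral>v. f v * \<psi> v \<partial>\<nu>)\<bar> = \<bar>\<integral>v. f v - f v * \<psi> v \<partial>\<nu>\<bar>"
      using f_\<nu> f\<psi>_\<nu> by simp
    also have "\<dots> \<le> (\<integral>v. \<bar>f v - f v * \<psi> v\<bar> \<partial>\<nu>)" by (rule integral_abs_bound)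
    also have "\<dots> \<le> (\<integral>v. B * (1 - \<psi> v) \<partial>\<nu>)"
    proof (rule integral_mono)
      fix v
      have "\<bar>f v - f v * \<psi> v\<bar> = \<bar>f v\<bar> * (1 - \<psi> v)"
        using \<psi>[of v] by (simp add: abs_mult flip: right_diff_distrib[of "f v" 1, simplified])
      then show "\<bar>f v - f v * \<psi> v\<bar> \<le> B * (1 - \<psi> v)" using B(2)[of v] \<psi>[of v] by (simp add: mult_right_mono)
    qed (use f_\<nu> f\<psi>_\<nu> \<psi>_\<nu> in auto)
    also have "\<dots> = B * (1 - (\<integral>v. \<psi> v \<partial>\<nu>))" using \<psi>_\<nu> by (simp add: prob_space)
    finally show ?thesis by (simp add: dist_real_def)
  qed
  have L_close: "B * (1 - (\<integral>v. \<psi> v \<partial>L)) < \<epsilon>"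
  proof -
    note [measurable_cong] = L(2)
    interpret prob_space L by fact
    have [measurable]: "{v. R < norm v} \<in> events"
    proof -
      have "{v \<in> space L. R < norm v} \<in> events" by measurable
      then show ?thesis using sets_eq_imp_space_eq[OF L(2)] by simp
    qed
    have "1 - prob {v. R < norm v} = (\<integral>v. 1 - indicator {v. R < norm v} v \<partial>L)"
      by (simp add: emeasure_eq_measure prob_space)
    also have "\<dots> \<le> (\<integral>v. \<psi> v \<partial>L)"
    proof (rule integral_mono)
      show "integrable L \<psi>" by (rule integrable_const_bound[where B = 1]) (auto simp: \<psi>)
      show "1 - indicator {v. R < norm v} v \<le> \<psi> v" for v
        using \<psi>[of v] by (auto simp: \<psi>_def indicator_def)
    qed (auto simp: emeasure_eq_measure)
    finally have "B * (1 - (\<integral>v. \<psi> v \<partial>L)) \<le> B * prob {v. R < norm v}"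
      using B(1) by (intro mult_left_mono) auto
    also have "\<dots> < \<epsilon>" using R(2) B(1) \<open>\<epsilon> > 0\<close> by (simp add: field_simps)
    finally show ?thesis .
  qed
  have "(\<lambda>n. B * (1 - (\<integral>v. \<psi> v \<partial>\<mu> n))) \<longlonglongrightarrow> B * (1 - (\<integral>v. \<psi> v \<partial>L))"
    by (intro tendsto_intros compactly_supported_integral_converges[OF \<mu> L conv cont supp])
  then have "\<forall>\<^sub>F n in sequentially. B * (1 - (\<integral>v. \<psi> v \<partial>\<mu> n)) < \<epsilon>"
    using L_close by (rule order_tendstoD)
  then have "\<forall>\<^sub>F n in sequentially. dist (\<integral>v. f v \<partial>\<mu> n) (\<integral>v. f v * \<psi> v \<partial>\<mu> n) \<le> \<epsilon>"
    by eventually_elim (use close[OF \<mu>] in \<open>meson le_less_trans less_imp_le\<close>)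
  moreover have "dist (\<integral>v. f v \<partial>L) (\<integral>v. f v * \<psi> v \<partial>L) \<le> \<epsilon>"
    using close[OF L] L_close by linarith
  moreover have "(\<lambda>n. \<integral>v. f v * \<psi> v \<partial>\<mu> n) \<longlonglongrightarrow> (\<integral>v. f v * \<psi> v \<partial>L)"
    by (rule compactly_supported_integral_converges[OF \<mu> L conv, of _ "R + 1"])
       (auto intro!: continuous_on_mult f cont simp: supp)
  ultimately show "\<exists>g c. g \<longlonglongrightarrow> c \<and> (\<forall>\<^sub>F n in sequentially. dist (\<integral>v. f v \<partial>\<mu> n) (g n) \<le> \<epsilon>) \<and> dist (\<integral>v. f v \<partial>L) c \<le> \<epsilon>"
    by blast
qed

section \<open>Independence of pairs\<close>

context prob_space begin

lemma indep_vars_reindex: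
  assumes inj: "inj_on h I" and X: "indep_vars M' X (h ` I)"
  shows "indep_vars (\<lambda>i. M' (h i)) (\<lambda>i. X (h i)) I"
  unfolding indep_vars_def2
proof (intro conjI ballI indep_setsI)
  show "random_variable (M' (h i)) (X (h i))" if "i \<in> I" for i
    using X that by (auto simp: indep_vars_def2)
  show "{X (h i) -` A \<inter> space M |A. A \<in> sets (M' (h i))} \<subseteq> events" if "i \<in> I" for i
    using X that by (auto simp: indep_vars_def2)
  fix A J
  assume J: "J \<noteq> {}" "J \<subseteq> I" "finite J"
    and A: "\<forall>j\<in>J. A j \<in> {X (h j) -` A \<inter> space M |A. A \<in> sets (M' (h j))}"
  have inv: "inv_into I h (h j) = j" if "j \<in> J" for j
    using inj that J by (auto intro: inv_into_f_f)
  have "prob (\<Inter>k\<in>h ` J. A (inv_into I h k)) = (\<Prod>k\<in>h ` J. prob (A (inv_into I h k)))"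
    using X[unfolded indep_vars_def2, THEN conjunct2]
    by (rule indep_setsD) (use J A inv in auto)
  moreover have "inj_on h J" using inj J(2) by (rule inj_on_subset)
  ultimately show "prob (\<Inter>j\<in>J. A j) = (\<Prod>j\<in>J. prob (A j))"
    by (simp add: prod.reindex inv)
qed

lemma independent_pairD:
  assumes "independent_pair M S U T V" "A \<in> sets S" "B \<in> sets T"
  shows "prob ((U -` A \<inter> space M) \<inter> (V -` B \<inter> space M)) = prob (U -` A \<inter> space M) * prob (V -` B \<inter> space M)"
  using assms unfolding independent_pair_def by (blast intro: indep_setD)

lemma independent_pair_compose:
  assumes UV: "independent_pair M S U T V" and f: "f \<in> measurable S S'" and g: "g \<in> measurable T T'"
  shows "independent_pair M S' (\<lambda>\<omega>. f (U \<omega>)) T' (\<lambda>\<omega>. g (V \<omega>))"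
proof -
  have rv: "random_variable S U" "random_variable T V" using UV by (auto simp: independent_pair_def)
  note f' = measurable_compose[OF rv(1) f] and g' = measurable_compose[OF rv(2) g]
  have eq: "(\<lambda>\<omega>. f (U \<omega>)) -` A \<inter> space M = U -` (f -` A \<inter> space S) \<inter> space M"
    "(\<lambda>\<omega>. g (V \<omega>)) -` B \<inter> space M = V -` (g -` B \<inter> space T) \<inter> space M" for A B
    using measurable_space[OF rv(1)] measurable_space[OF rv(2)] by auto
  have "indep_set {(\<lambda>\<omega>. f (U \<omega>)) -` A \<inter> space M |A. A \<in> sets S'} {(\<lambda>\<omega>. g (V \<omega>)) -` B \<inter> space M |B. B \<in> sets T'}"
  proof (rule indep_setI)
    fix a b
    assume "a \<in> {(\<lambda>\<omega>. f (U \<omega>)) -` A \<inter> space M |A. A \<in> sets S'}"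
      and "b \<in> {(\<lambda>\<omega>. g (V \<omega>)) -` B \<inter> space M |B. B \<in> sets T'}"
    then obtain A B where AB: "A \<in> sets S'" "B \<in> sets T'"
      and a: "a = U -` (f -` A \<inter> space S) \<inter> space M" and b: "b = V -` (g -` B \<inter> space T) \<inter> space M"
      unfolding eq by auto
    show "prob (a \<inter> b) = prob a * prob b"
      unfolding a b using UV by (rule independent_pairD) (use AB f g in \<open>auto intro: measurable_sets\<close>)
  qed (use f' g' in \<open>auto intro: measurable_sets\<close>)
  then show ?thesis using f' g' by (simp add: independent_pair_def)
qed

lemma independent_pair_distr:
  assumes UV: "independent_pair M S U T V"
  shows "distr M (S \<Otimes>\<^sub>M T) (\<lambda>\<omega>. (U \<omega>, V \<omega>)) = distr M S U \<Otimes>\<^sub>M distr M T V"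
proof (rule pair_measure_eqI[symmetric])
  have [measurable]: "random_variable S U" "random_variable T V" using UV by (auto simp: independent_pair_def)
  interpret U: prob_space "distr M S U" by (rule prob_space_distr) simp
  interpret V: prob_space "distr M T V" by (rule prob_space_distr) simp
  show "sigma_finite_measure (distr M S U)" "sigma_finite_measure (distr M T V)" by unfold_locales
  fix A B assume "A \<in> sets (distr M S U)" "B \<in> sets (distr M T V)"
  then have AB [measurable]: "A \<in> sets S" "B \<in> sets T" by auto
  have "(\<lambda>\<omega>. (U \<omega>, V \<omega>)) -` (A \<times> B) \<inter> space M = (U -` A \<inter> space M) \<inter> (V -` B \<inter> space M)" by auto
  then show "emeasure (distr M S U) A * emeasure (distr M T V) B =
    emeasure (distr M (S \<Otimes>\<^sub>M T) (\<lambda>\<omega>. (U \<omega>, V \<omega>))) (A \<times> B)"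
    by (simp add: emeasure_distr emeasure_eq_measure independent_pairD[OF UV AB] ennreal_mult)
qed simp

lemma independent_pair_imp_indep_var:
  fixes U V :: "'a \<Rightarrow> 'b::topological_space"
  assumes UV: "independent_pair M borel U borel V"
  shows "indep_var borel U borel V"
  unfolding indep_var_eq
proof (intro conjI indep_set_sigma_sets)
  show "random_variable borel U" "random_variable borel V"
    "indep_set {U -` A \<inter> space M |A. A \<in> sets borel} {V -` A \<inter> space M |A. A \<in> sets borel}"
    using UV by (auto simp: independent_pair_def)
  have "Int_stable {W -` A \<inter> space M |A. A \<in> sets borel}" for W :: "'a \<Rightarrow> 'b"
    by (rule Int_stableI) (auto, metis Int_assoc Int_left_commute sets.Int vimage_Int Int_absorb)
  then show "Int_stable {U -` A \<inter> space M |A. A \<in> sets borel}"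
    "Int_stable {V -` A \<inter> space M |A. A \<in> sets borel}" by auto
qed

text \<open>The probability of a finite intersection of events \<open>X i \<in> A i\<close> and \<open>V i \<in> B i\<close> factorises, first because the
  families are independent of one another, then within each family. Rectangles \<open>A \<times> B\<close> are stable under
  intersection and generate the product sigma-algebra.\<close>

lemma indep_vars_Pair:
  assumes X: "indep_vars (\<lambda>_. S) X I" and V: "indep_vars (\<lambda>_. T) V I"
    and XV: "independent_pair M (Pi\<^sub>M I (\<lambda>_. S)) (\<lambda>\<omega>. \<lambda>i\<in>I. X i \<omega>) (Pi\<^sub>M I (\<lambda>_. T)) (\<lambda>\<omega>. \<lambda>i\<in>I. V i \<omega>)"
  shows "indep_vars (\<lambda>_. S \<Otimes>\<^sub>M T) (\<lambda>i \<omega>. (X i \<omega>, V i \<omega>)) I"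
proof -
  have rv: "random_variable S (X i)" "random_variable T (V i)" if "i \<in> I" for i
    using X V that by (auto simp: indep_vars_def2)
  define G where "G i = {(X i -` A \<inter> space M) \<inter> (V i -` B \<inter> space M) |A B. A \<in> sets S \<and> B \<in> sets T}" for i
  have "indep_sets G I"
  proof (rule indep_setsI)
    show "G i \<subseteq> events" if "i \<in> I" for i
      using rv[OF that] by (auto simp: G_def intro!: sets.Int measurable_sets)
    fix C J assume J: "J \<noteq> {}" "J \<subseteq> I" "finite J" and CG: "\<forall>j\<in>J. C j \<in> G j"
    have "\<exists>A B. A \<in> sets S \<and> B \<in> sets T \<and> C j = (X j -` A \<inter> space M) \<inter> (V j -` B \<inter> space M)"
      if "j \<in> J" for j
    proof -
      have "C j \<in> G j" using CG that by blast
      then show ?thesis by (simp only: G_def mem_Collect_eq) blast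
    qed
    then obtain A B where A: "\<And>j. j \<in> J \<Longrightarrow> A j \<in> sets S" and B: "\<And>j. j \<in> J \<Longrightarrow> B j \<in> sets T"
      and C: "\<And>j. j \<in> J \<Longrightarrow> C j = (X j -` A j \<inter> space M) \<inter> (V j -` B j \<inter> space M)"
      by metis
    let ?A = "{u \<in> space (Pi\<^sub>M I (\<lambda>_. S)). \<forall>j\<in>J. u j \<in> A j}"
    let ?B = "{u \<in> space (Pi\<^sub>M I (\<lambda>_. T)). \<forall>j\<in>J. u j \<in> B j}"
    have AB: "?A \<in> sets (Pi\<^sub>M I (\<lambda>_. S))" "?B \<in> sets (Pi\<^sub>M I (\<lambda>_. T))"
      using J A B by (auto intro!: sets.sets_Collect_finite_All' sets_Collect_single' measurable_sets)
    have A': "(\<lambda>\<omega>. \<lambda>i\<in>I. X i \<omega>) -` ?A \<inter> space M = (\<Inter>j\<in>J. X j -` A j \<inter> space M)"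
      using J rv[THEN measurable_space] by (auto simp: space_PiM)
    have B': "(\<lambda>\<omega>. \<lambda>i\<in>I. V i \<omega>) -` ?B \<inter> space M = (\<Inter>j\<in>J. V j -` B j \<inter> space M)"
      using J rv[THEN measurable_space] by (auto simp: space_PiM)
    have "(\<Inter>j\<in>J. C j) = (\<Inter>j\<in>J. X j -` A j \<inter> space M) \<inter> (\<Inter>j\<in>J. V j -` B j \<inter> space M)"
      using C by auto
    then have "prob (\<Inter>j\<in>J. C j) = prob (\<Inter>j\<in>J. X j -` A j \<inter> space M) * prob (\<Inter>j\<in>J. V j -` B j \<inter> space M)"
      using independent_pairD[OF XV AB] unfolding A' B' by simp
    also have "prob (\<Inter>j\<in>J. X j -` A j \<inter> space M) = (\<Prod>j\<in>J. prob (X j -` A j \<inter> space M))"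
      using X[unfolded indep_vars_def2, THEN conjunct2] by (rule indep_setsD) (use J A in auto)
    also have "prob (\<Inter>j\<in>J. V j -` B j \<inter> space M) = (\<Prod>j\<in>J. prob (V j -` B j \<inter> space M))"
      using V[unfolded indep_vars_def2, THEN conjunct2] by (rule indep_setsD) (use J B in auto)
    also have "(\<Prod>j\<in>J. prob (X j -` A j \<inter> space M)) * (\<Prod>j\<in>J. prob (V j -` B j \<inter> space M)) = (\<Prod>j\<in>J. prob (C j))"
      unfolding prod.distrib[symmetric]
    proof (intro prod.cong refl)
      fix j assume j: "j \<in> J"
      have coord: "independent_pair M S (X j) T (V j)"
        using independent_pair_compose[OF XV, of "\<lambda>u. u j" S "\<lambda>u. u j" T] j J by auto
      show "prob (X j -` A j \<inter> space M) * prob (V j -` B j \<inter> space M) = prob (C j)"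
        using independent_pairD[OF coord A B] j C by simp
    qed
    finally show "prob (\<Inter>j\<in>J. C j) = (\<Prod>j\<in>J. prob (C j))" .
  qed
  moreover have "Int_stable (G i)" for i
  proof (rule Int_stableI)
    fix a b assume "a \<in> G i" "b \<in> G i"
    then obtain A B A' B' where "A \<in> sets S" "B \<in> sets T" "A' \<in> sets S" "B' \<in> sets T"
      "a = (X i -` A \<inter> space M) \<inter> (V i -` B \<inter> space M)" "b = (X i -` A' \<inter> space M) \<inter> (V i -` B' \<inter> space M)"
      by (auto simp: G_def)
    then show "a \<inter> b \<in> G i"
      unfolding G_def by (intro CollectI exI[of _ "A \<inter> A'"] exI[of _ "B \<inter> B'"]) auto
  qed
  ultimately have "indep_sets (\<lambda>i. sigma_sets (space M) (G i)) I"
    by (rule indep_sets_sigma)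
  moreover have "{(\<lambda>\<omega>. (X i \<omega>, V i \<omega>)) -` C \<inter> space M |C. C \<in> sets (S \<Otimes>\<^sub>M T)} \<subseteq> sigma_sets (space M) (G i)"
    if "i \<in> I" for i
  proof -
    have "{(\<lambda>\<omega>. (X i \<omega>, V i \<omega>)) -` C \<inter> space M |C. C \<in> sets (S \<Otimes>\<^sub>M T)} =
      sigma_sets (space M) {(\<lambda>\<omega>. (X i \<omega>, V i \<omega>)) -` C \<inter> space M |C. C \<in> {a \<times> b |a b. a \<in> sets S \<and> b \<in> sets T}}"
      unfolding sets_pair_measure
      by (rule sigma_sets_vimage_commute) (use rv[OF that, THEN measurable_space] in auto)
    also have "\<dots> \<subseteq> sigma_sets (space M) (G i)"
    proof (rule sigma_sets_mono', safe)
      fix a b assume "a \<in> sets S" "b \<in> sets T"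
      moreover have "(\<lambda>\<omega>. (X i \<omega>, V i \<omega>)) -` (a \<times> b) \<inter> space M = (X i -` a \<inter> space M) \<inter> (V i -` b \<inter> space M)" by auto
      ultimately show "(\<lambda>\<omega>. (X i \<omega>, V i \<omega>)) -` (a \<times> b) \<inter> space M \<in> G i"
        unfolding G_def by blast
    qed
    finally show ?thesis .
  qed
  ultimately have "indep_sets (\<lambda>i. {(\<lambda>\<omega>. (X i \<omega>, V i \<omega>)) -` C \<inter> space M |C. C \<in> sets (S \<Otimes>\<^sub>M T)}) I"
    by (rule indep_sets_mono_sets)
  then show ?thesis
    unfolding indep_vars_def2 using rv by auto
qed

section \<open>Laws of large numbers and the central limit theorem\<close>

text \<open>Bienayme's identity: the mixed terms vanish by independence.\<close>

lemma expectation_square_sum_indep: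
  fixes X :: "'i \<Rightarrow> 'a \<Rightarrow> real"
  assumes I: "finite I" and X: "indep_vars (\<lambda>_. borel) X I"
    and sq: "\<And>i. i \<in> I \<Longrightarrow> integrable M (\<lambda>\<omega>. (X i \<omega>)\<^sup>2)"
    and mean: "\<And>i. i \<in> I \<Longrightarrow> expectation (X i) = 0"
  shows "integrable M (\<lambda>\<omega>. (\<Sum>i\<in>I. X i \<omega>)\<^sup>2)"
    and "expectation (\<lambda>\<omega>. (\<Sum>i\<in>I. X i \<omega>)\<^sup>2) = (\<Sum>i\<in>I. expectation (\<lambda>\<omega>. (X i \<omega>)\<^sup>2))"
proof -
  have rv: "random_variable borel (X i)" if "i \<in> I" for i
    using X that by (auto simp: indep_vars_def2)
  have int: "integrable M (X i)" if "i \<in> I" for i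
    using rv[OF that] sq[OF that] by (rule square_integrable_imp_integrable)
  have mixed: "integrable M (\<lambda>\<omega>. X i \<omega> * X j \<omega>) \<and>
      expectation (\<lambda>\<omega>. X i \<omega> * X j \<omega>) = (if i = j then expectation (\<lambda>\<omega>. (X i \<omega>)\<^sup>2) else 0)"
    if "i \<in> I" "j \<in> I" for i j
  proof (cases "i = j")
    case True
    then show ?thesis using sq[OF that(1)] by (simp add: power2_eq_square)
  next
    case False
    have ind: "indep_vars (\<lambda>_. borel) X {i, j}"
      using X by (rule indep_vars_subset) (use that in auto)
    have "integrable M (\<lambda>\<omega>. \<Prod>k\<in>{i, j}. X k \<omega>)"
      by (rule indep_vars_integrable[OF _ ind]) (use int that in auto)
    moreover have "expectation (\<lambda>\<omega>. \<Prod>k\<in>{i, j}. X k \<omega>) = (\<Prod>k\<in>{i, j}. expectation (X k))"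
      by (rule indep_vars_lebesgue_integral[OF _ ind]) (use int that in auto)
    ultimately show ?thesis using False mean that by simp
  qed
  have expand: "(\<Sum>i\<in>I. X i \<omega>)\<^sup>2 = (\<Sum>i\<in>I. \<Sum>j\<in>I. X i \<omega> * X j \<omega>)" for \<omega>
    by (simp add: power2_eq_square sum_product)
  show "integrable M (\<lambda>\<omega>. (\<Sum>i\<in>I. X i \<omega>)\<^sup>2)"
    unfolding expand using mixed by (intro Bochner_Integration.integrable_sum) auto
  have "expectation (\<lambda>\<omega>. (\<Sum>i\<in>I. X i \<omega>)\<^sup>2) = (\<Sum>i\<in>I. \<Sum>j\<in>I. expectation (\<lambda>\<omega>. X i \<omega> * X j \<omega>))"
    unfolding expand using mixed
    by (simp add: Bochner_Integration.integral_sum Bochner_Integration.integrable_sum)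
  also have "\<dots> = (\<Sum>i\<in>I. \<Sum>j\<in>I. if i = j then expectation (\<lambda>\<omega>. (X i \<omega>)\<^sup>2) else 0)"
    using mixed by (intro sum.cong) auto
  also have "\<dots> = (\<Sum>i\<in>I. expectation (\<lambda>\<omega>. (X i \<omega>)\<^sup>2))"
    using I by (intro sum.cong) auto
  finally show "expectation (\<lambda>\<omega>. (\<Sum>i\<in>I. X i \<omega>)\<^sup>2) = (\<Sum>i\<in>I. expectation (\<lambda>\<omega>. (X i \<omega>)\<^sup>2))" .
qed

lemma expectation_abs_le_sqrt:
  fixes Z :: "'a \<Rightarrow> real"
  assumes [measurable]: "random_variable borel Z" and sq: "integrable M (\<lambda>\<omega>. (Z \<omega>)\<^sup>2)"
  shows "expectation (\<lambda>\<omega>. \<bar>Z \<omega>\<bar>) \<le> sqrt (expectation (\<lambda>\<omega>. (Z \<omega>)\<^sup>2))"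
proof (rule real_le_rsqrt)
  have "integrable M Z" using sq by (rule square_integrable_imp_integrable[rotated]) simp
  then have "variance (\<lambda>\<omega>. \<bar>Z \<omega>\<bar>) = expectation (\<lambda>\<omega>. \<bar>Z \<omega>\<bar>\<^sup>2) - (expectation (\<lambda>\<omega>. \<bar>Z \<omega>\<bar>))\<^sup>2"
    using sq by (intro variance_eq) auto
  then show "(expectation (\<lambda>\<omega>. \<bar>Z \<omega>\<bar>))\<^sup>2 \<le> expectation (\<lambda>\<omega>. (Z \<omega>)\<^sup>2)"
    using variance_positive[of "\<lambda>\<omega>. \<bar>Z \<omega>\<bar>"] by simp
qed

lemma bounded_mean_deviation:
  fixes X :: "nat \<Rightarrow> 'a \<Rightarrow> real"
  assumes X: "indep_vars (\<lambda>_. borel) X UNIV" and bdd: "\<And>n \<omega>. \<bar>X n \<omega>\<bar> \<le> K"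
    and mean: "\<And>n. expectation (X n) = c" and n: "n > 0"
  shows "expectation (\<lambda>\<omega>. \<bar>(\<Sum>j<n. X j \<omega>) / real n - c\<bar>) \<le> 2 * K / sqrt (real n)"
proof -
  have [measurable]: "random_variable borel (X i)" for i
    using X by (auto simp: indep_vars_def2)
  have int: "integrable M (X i)" for i
    by (rule integrable_const_bound[where B = K]) (auto simp: bdd)
  have "K \<ge> 0" using bdd[of 0 undefined] by linarith
  have "\<bar>c\<bar> \<le> expectation (\<lambda>\<omega>. \<bar>X 0 \<omega>\<bar>)" using integral_abs_bound[of M "X 0"] mean by simp
  also have "\<dots> \<le> expectation (\<lambda>_. K)" using int bdd by (intro integral_mono) auto
  finally have c: "\<bar>c\<bar> \<le> K" by (simp add: prob_space)
  let ?Y = "\<lambda>j \<omega>. X j \<omega> - c"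
  have Y_le: "(?Y j \<omega>)\<^sup>2 \<le> (2 * K)\<^sup>2" for j \<omega>
  proof -
    have "\<bar>?Y j \<omega>\<bar> \<le> \<bar>2 * K\<bar>" using bdd[of j \<omega>] c by linarith
    then show ?thesis by (simp only: abs_le_square_iff)
  qed
  have Y_sq: "integrable M (\<lambda>\<omega>. (?Y j \<omega>)\<^sup>2)" for j
    using Y_le by (intro integrable_const_bound[where B = "(2 * K)\<^sup>2"]) auto
  have Y_ind: "indep_vars (\<lambda>_. borel) ?Y {..<n}"
    by (rule indep_vars_subset[OF indep_vars_compose2[OF X]]) auto
  have Y_mean: "expectation (?Y j) = 0" for j
    using int mean by (simp add: prob_space)
  note S = expectation_square_sum_indep[OF finite_lessThan Y_ind Y_sq Y_mean]
  have "expectation (\<lambda>\<omega>. (\<Sum>j<n. ?Y j \<omega>)\<^sup>2) = (\<Sum>j<n. expectation (\<lambda>\<omega>. (?Y j \<omega>)\<^sup>2))" by (rule S)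
  also have "\<dots> \<le> (\<Sum>j<n. expectation (\<lambda>_. (2 * K)\<^sup>2))"
    using Y_le Y_sq by (intro sum_mono integral_mono) auto
  finally have S_le: "expectation (\<lambda>\<omega>. (\<Sum>j<n. ?Y j \<omega>)\<^sup>2) \<le> real n * (2 * K)\<^sup>2" by (simp add: prob_space)
  have "(\<Sum>j<n. X j \<omega>) / real n - c = (\<Sum>j<n. ?Y j \<omega>) / real n" for \<omega>
    using n by (simp add: sum_subtractf field_simps)
  then have "expectation (\<lambda>\<omega>. \<bar>(\<Sum>j<n. X j \<omega>) / real n - c\<bar>) = expectation (\<lambda>\<omega>. \<bar>\<Sum>j<n. ?Y j \<omega>\<bar>) / real n"
    by simp
  also have "\<dots> \<le> sqrt (expectation (\<lambda>\<omega>. (\<Sum>j<n. ?Y j \<omega>)\<^sup>2)) / real n"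
    by (intro divide_right_mono expectation_abs_le_sqrt S) auto
  also have "\<dots> \<le> sqrt (real n * (2 * K)\<^sup>2) / real n"
    using S_le by (intro divide_right_mono) auto
  also have "\<dots> = 2 * K / sqrt (real n)"
    using n \<open>K \<ge> 0\<close> by (simp add: real_sqrt_mult real_div_sqrt field_simps)
  finally show ?thesis .
qed

text \<open>The summands, which have a first moment only, are truncated at a level \<open>K\<close>: the truncated means deviate by
  \<open>O(1 / sqrt n)\<close> in the mean, and the error of truncation is uniformly small because all summands have the
  same law.\<close>

lemma weak_law_mean_real:
  fixes X :: "nat \<Rightarrow> 'a \<Rightarrow> real"
  assumes X: "indep_vars (\<lambda>_. borel) X UNIV" and D: "\<And>n. distr M borel (X n) = D"
    and int: "integrable D (\<lambda>x. x)"
  shows "(\<lambda>n. expectation (\<lambda>\<omega>. \<bar>(\<Sum>j<n. X j \<omega>) / real n - (\<integral>x. x \<partial>D)\<bar>)) \<longlonglongrightarrow> 0"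
proof (rule tendstoI)
  fix \<epsilon> :: real assume "\<epsilon> > 0"
  have [measurable]: "random_variable borel (X i)" for i
    using X by (auto simp: indep_vars_def2)
  have D_sets [measurable_cong]: "sets D = sets borel" using D[of 0] by auto
  have D_int: "(\<integral>x. f x \<partial>D) = expectation (\<lambda>\<omega>. f (X n \<omega>))" "integrable D f = integrable M (\<lambda>\<omega>. f (X n \<omega>))"
    if [measurable]: "f \<in> borel_measurable borel" for f :: "real \<Rightarrow> real" and n
    by (subst D[of n, symmetric], simp add: integral_distr integrable_distr_eq)+
  let ?h = "\<lambda>(K::nat) x::real. if \<bar>x\<bar> \<le> real K then x else 0"
  have "(\<lambda>K. \<integral>x. \<bar>x - ?h K x\<bar> \<partial>D) \<longlonglongrightarrow> (\<integral>x. 0 \<partial>D)"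
  proof (rule integral_dominated_convergence[where w = "\<lambda>x. \<bar>x\<bar>"])
    have "\<forall>\<^sub>F K in sequentially. \<bar>x - ?h K x\<bar> = 0" for x
      using eventually_ge_at_top[of "nat \<lceil>\<bar>x\<bar>\<rceil>"] by eventually_elim (auto simp: nat_ceiling_le_eq)
    then show "AE x in D. (\<lambda>K. \<bar>x - ?h K x\<bar>) \<longlonglongrightarrow> 0"
      by (intro AE_I2 tendsto_eventually) auto
    show "(\<lambda>x. \<bar>x - ?h K x\<bar>) \<in> borel_measurable D" for K by measurable
    show "integrable D (\<lambda>x. \<bar>x\<bar>)" using int by (rule integrable_abs)
    show "AE x in D. norm \<bar>x - ?h K x\<bar> \<le> \<bar>x\<bar>" for K by (intro AE_I2) simp
  qed simp
  then have "(\<lambda>K. \<integral>x. \<bar>x - ?h K x\<bar> \<partial>D) \<longlonglongrightarrow> 0" by (simp only: integral_zero)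
  then have "\<forall>\<^sub>F K in sequentially. (\<integral>x. \<bar>x - ?h K x\<bar> \<partial>D) < \<epsilon> / 4"
    by (rule order_tendstoD) (use \<open>\<epsilon> > 0\<close> in simp)
  then obtain K where K: "(\<integral>x. \<bar>x - ?h K x\<bar> \<partial>D) < \<epsilon> / 4" using eventually_happens'[OF sequentially_bot] by blast
  define h where "h = ?h K"
  have [measurable]: "h \<in> borel_measurable borel" unfolding h_def by measurable
  have h_le: "\<bar>h x\<bar> \<le> real K" for x by (auto simp: h_def)
  define \<mu> where "\<mu> = (\<integral>x. x \<partial>D)"
  define \<nu> where "\<nu> = (\<integral>x. h x \<partial>D)"
  have Xint: "integrable M (X j)" for j using int D_int(2)[of "\<lambda>x. x" j] by simp
  have hint: "integrable M (\<lambda>\<omega>. h (X j \<omega>))" for j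
    by (rule integrable_const_bound[where B = "real K"]) (auto simp: h_le)
  have tail: "expectation (\<lambda>\<omega>. \<bar>X j \<omega> - h (X j \<omega>)\<bar>) < \<epsilon> / 4" for j
    using K D_int(1)[of "\<lambda>x. \<bar>x - h x\<bar>" j] by (simp add: h_def)
  have "\<mu> - \<nu> = expectation (\<lambda>\<omega>. X 0 \<omega> - h (X 0 \<omega>))"
    using D_int(1)[of "\<lambda>x. x" 0] D_int(1)[of h 0] Xint hint by (simp add: \<mu>_def \<nu>_def)
  then have "\<bar>\<mu> - \<nu>\<bar> \<le> expectation (\<lambda>\<omega>. \<bar>X 0 \<omega> - h (X 0 \<omega>)\<bar>)"
    by (simp only: integral_abs_bound)
  then have \<mu>\<nu>: "\<bar>\<mu> - \<nu>\<bar> < \<epsilon> / 4"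
    using tail[of 0] by linarith
  have bound: "expectation (\<lambda>\<omega>. \<bar>(\<Sum>j<n. X j \<omega>) / real n - \<mu>\<bar>) \<le> \<epsilon> / 2 + 2 * real K / sqrt (real n)"
    if n: "n > 0" for n
  proof -
    let ?A = "\<lambda>\<omega>. (\<Sum>j<n. \<bar>X j \<omega> - h (X j \<omega>)\<bar>) / real n"
    let ?B = "\<lambda>\<omega>. \<bar>(\<Sum>j<n. h (X j \<omega>)) / real n - \<nu>\<bar>"
    have "expectation (\<lambda>\<omega>. \<bar>(\<Sum>j<n. X j \<omega>) / real n - \<mu>\<bar>) \<le> expectation (\<lambda>\<omega>. ?A \<omega> + ?B \<omega> + \<epsilon> / 4)"
    proof (rule integral_mono)
      fix \<omega>
      have "(\<Sum>j<n. X j \<omega>) / real n - \<mu> = (\<Sum>j<n. X j \<omega> - h (X j \<omega>)) / real n +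
          ((\<Sum>j<n. h (X j \<omega>)) / real n - \<nu>) - (\<mu> - \<nu>)"
        by (simp add: sum_subtractf diff_divide_distrib)
      moreover have "\<bar>(\<Sum>j<n. X j \<omega> - h (X j \<omega>)) / real n\<bar> \<le> ?A \<omega>"
        by (simp add: abs_divide divide_right_mono sum_abs)
      ultimately show "\<bar>(\<Sum>j<n. X j \<omega>) / real n - \<mu>\<bar> \<le> ?A \<omega> + ?B \<omega> + \<epsilon> / 4"
        using \<mu>\<nu> by linarith
    qed (use Xint hint in auto)
    also have "\<dots> = (\<Sum>j<n. expectation (\<lambda>\<omega>. \<bar>X j \<omega> - h (X j \<omega>)\<bar>)) / real n + expectation ?B + \<epsilon> / 4"
      using Xint hint by (simp add: prob_space)
    also have "(\<Sum>j<n. expectation (\<lambda>\<omega>. \<bar>X j \<omega> - h (X j \<omega>)\<bar>)) / real n \<le> (\<Sum>j<n. \<epsilon> / 4) / real n"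
      by (rule divide_right_mono, rule sum_mono, rule less_imp_le, rule tail) simp
    also have "(\<Sum>j<n. \<epsilon> / 4) / real n = \<epsilon> / 4" using n by simp
    also have "expectation ?B \<le> 2 * real K / sqrt (real n)"
    proof (rule bounded_mean_deviation[OF _ _ _ n])
      show "indep_vars (\<lambda>_. borel) (\<lambda>j \<omega>. h (X j \<omega>)) UNIV" by (rule indep_vars_compose2[OF X]) auto
      show "expectation (\<lambda>\<omega>. h (X j \<omega>)) = \<nu>" for j using D_int(1)[of h j] by (simp add: \<nu>_def)
    qed (rule h_le)
    finally show ?thesis by simp
  qed
  have "(\<lambda>n. 2 * real K / sqrt (real n)) \<longlonglongrightarrow> 0"
    by (intro tendsto_divide_0[OF tendsto_const] filterlim_at_top_imp_at_infinity
        filterlim_compose[OF sqrt_at_top filterlim_real_sequentially])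
  then have "\<forall>\<^sub>F n in sequentially. 2 * real K / sqrt (real n) < \<epsilon> / 2"
    using \<open>\<epsilon> > 0\<close> by (intro order_tendstoD) auto
  then show "\<forall>\<^sub>F n in sequentially. dist (expectation (\<lambda>\<omega>. \<bar>(\<Sum>j<n. X j \<omega>) / real n - (\<integral>x. x \<partial>D)\<bar>)) 0 < \<epsilon>"
    using eventually_gt_at_top[of "0::nat"]
  proof eventually_elim
    case (elim n)
    then show ?case using bound[OF elim(2)] by (simp add: \<mu>_def)
  qed
qed

text \<open>Convergence in mean passes to vectors and matrices through their coordinates, and Markov's
  inequality turns it into convergence in probability.\<close>

lemma weak_law_large_numbers:
  fixes X :: "nat \<Rightarrow> 'a \<Rightarrow> 'b::euclidean_space"
  assumes X: "indep_vars (\<lambda>_. borel) X UNIV" and D: "\<And>n. distr M borel (X n) = D"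
    and int: "integrable D (\<lambda>x. x)" and \<delta>: "\<delta> > 0"
  shows "(\<lambda>n. prob {\<omega> \<in> space M. \<delta> \<le> norm ((1 / real n) *\<^sub>R (\<Sum>j<n. X j \<omega>) - (\<integral>x. x \<partial>D))}) \<longlonglongrightarrow> 0"
proof -
  have [measurable]: "random_variable borel (X i)" for i
    using X by (auto simp: indep_vars_def2)
  have D_sets [measurable_cong]: "sets D = sets borel" using D[of 0] by auto
  have Xint: "integrable M (X j)" for j
    using int by (subst (asm) D[of j, symmetric]) (simp add: integrable_distr_eq)
  let ?d = "\<lambda>n \<omega>. (1 / real n) *\<^sub>R (\<Sum>j<n. X j \<omega>) - (\<integral>x. x \<partial>D)"
  have comp: "(\<lambda>n. expectation (\<lambda>\<omega>. \<bar>?d n \<omega> \<bullet> b\<bar>)) \<longlonglongrightarrow> 0" for b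
  proof -
    have mb: "(\<lambda>x. x \<bullet> b) \<in> borel_measurable D" by measurable
    have "(\<lambda>n. expectation (\<lambda>\<omega>. \<bar>(\<Sum>j<n. X j \<omega> \<bullet> b) / real n - (\<integral>x. x \<partial>distr D borel (\<lambda>x. x \<bullet> b))\<bar>)) \<longlonglongrightarrow> 0"
    proof (rule weak_law_mean_real)
      show "indep_vars (\<lambda>_. borel) (\<lambda>j \<omega>. X j \<omega> \<bullet> b) UNIV" by (rule indep_vars_compose2[OF X]) auto
      show "distr M borel (\<lambda>\<omega>. X n \<omega> \<bullet> b) = distr D borel (\<lambda>x. x \<bullet> b)" for n
      proof -
        have "distr (distr M borel (X n)) borel (\<lambda>x. x \<bullet> b) = distr M borel (\<lambda>\<omega>. X n \<omega> \<bullet> b)"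
          by (subst distr_distr) (simp_all add: comp_def)
        then show ?thesis by (simp only: D)
      qed
      show "integrable (distr D borel (\<lambda>x. x \<bullet> b)) (\<lambda>x. x)"
        by (subst integrable_distr_eq[OF mb]) (simp, rule integrable_inner_left[OF int])
    qed
    moreover have "(\<integral>x. x \<partial>distr D borel (\<lambda>x. x \<bullet> b)) = (\<integral>x. x \<partial>D) \<bullet> b"
      by (subst integral_distr[OF mb]) (simp, rule integral_inner_left[OF int])
    ultimately show ?thesis by (simp add: inner_diff_left inner_sum_left)
  qed
  have d_int: "integrable M (\<lambda>\<omega>. ?d n \<omega>)" for n using Xint by auto
  have "(\<lambda>n. (\<Sum>b\<in>Basis. expectation (\<lambda>\<omega>. \<bar>?d n \<omega> \<bullet> b\<bar>)) / \<delta>) \<longlonglongrightarrow> (\<Sum>b\<in>(Basis::'b set). 0) / \<delta>"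
    by (intro tendsto_intros comp) (use \<delta> in auto)
  then have lim: "(\<lambda>n. (\<Sum>b\<in>Basis. expectation (\<lambda>\<omega>. \<bar>?d n \<omega> \<bullet> b\<bar>)) / \<delta>) \<longlonglongrightarrow> 0" by simp
  have le: "prob {\<omega> \<in> space M. \<delta> \<le> norm (?d n \<omega>)} \<le> (\<Sum>b\<in>Basis. expectation (\<lambda>\<omega>. \<bar>?d n \<omega> \<bullet> b\<bar>)) / \<delta>" for n
  proof -
    have "prob {\<omega> \<in> space M. \<delta> \<le> norm (?d n \<omega>)} \<le> expectation (\<lambda>\<omega>. norm (?d n \<omega>)) / \<delta>"
      by (rule integral_Markov_inequality_measure[where A = "{}"]) (use d_int \<delta> in auto)
    also have "expectation (\<lambda>\<omega>. norm (?d n \<omega>)) \<le> expectation (\<lambda>\<omega>. \<Sum>b\<in>Basis. \<bar>?d n \<omega> \<bullet> b\<bar>)"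
      using d_int by (intro integral_mono norm_le_l1) auto
    also have "\<dots> = (\<Sum>b\<in>Basis. expectation (\<lambda>\<omega>. \<bar>?d n \<omega> \<bullet> b\<bar>))"
      using d_int by (intro Bochner_Integration.integral_sum) auto
    finally show ?thesis using \<delta> by (simp add: divide_right_mono)
  qed
  show ?thesis
    by (rule tendsto_sandwich[OF _ _ tendsto_const lim]) (auto simp: le)
qed

text \<open>The one-dimensional central limit theorem, read as convergence of a characteristic function at one
  point; applied to \<open>t \<bullet> X\<close> for a random vector \<open>X\<close> it yields the characteristic functional at \<open>t\<close>. A vanishing variance is
  treated separately, since the normalisation by the standard deviation is then not available.\<close>

lemma clt_iexp:
  fixes W :: "nat \<Rightarrow> 'a \<Rightarrow> real"
  assumes W: "indep_vars (\<lambda>_. borel) W UNIV" and D: "\<And>n. distr M borel (W n) = D"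
    and mean: "\<And>n. expectation (W n) = 0" and sq: "\<And>n. integrable M (\<lambda>\<omega>. (W n \<omega>)\<^sup>2)"
    and v: "\<And>n. expectation (\<lambda>\<omega>. (W n \<omega>)\<^sup>2) = v"
  shows "(\<lambda>n. CLINT \<omega>|M. iexp ((\<Sum>j<n. W j \<omega>) / sqrt (real n))) \<longlonglongrightarrow> complex_of_real (exp (- v / 2))"
proof (cases "v = 0")
  case True
  have [measurable]: "random_variable borel (W i)" for i
    using W by (auto simp: indep_vars_def2)
  have "AE \<omega> in M. (W j \<omega>)\<^sup>2 = 0" for j
    using sq v True by (subst integral_nonneg_eq_0_iff_AE[symmetric]) auto
  then have "AE \<omega> in M. \<forall>j. W j \<omega> = 0" by (simp add: AE_all_countable)
  then have "(CLINT \<omega>|M. iexp ((\<Sum>j<n. W j \<omega>) / sqrt (real n))) = (CLINT \<omega>|M. 1)" for n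
    by (intro integral_cong_AE) (auto elim!: eventually_mono)
  then show ?thesis using True by (simp add: prob_space)
next
  case False
  have [measurable]: "random_variable borel (W i)" for i
    using W by (auto simp: indep_vars_def2)
  have "v \<ge> 0" using v[of 0] by (metis integral_nonneg_AE AE_I2 zero_le_power2)
  then have v0: "v > 0" using False by simp
  have "weak_conv_m (\<lambda>n. distr M borel (\<lambda>\<omega>. (\<Sum>j<n. W j \<omega>) / sqrt (real n * (sqrt v)\<^sup>2))) std_normal_distribution"
    by (rule central_limit_theorem_zero_mean[OF W mean _ sq _ D]) (use v0 v mean in auto)
  \<comment> \<open>Evaluation at \<open>sqrt v\<close> undoes the normalisation by the standard deviation.\<close>
  then have "(\<lambda>n. char (distr M borel (\<lambda>\<omega>. (\<Sum>j<n. W j \<omega>) / sqrt (real n * (sqrt v)\<^sup>2))) (sqrt v))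
      \<longlonglongrightarrow> char std_normal_distribution (sqrt v)"
    by (intro levy_continuity1 real_distribution_distr real_dist_normal_dist) auto
  moreover have "char (distr M borel (\<lambda>\<omega>. (\<Sum>j<n. W j \<omega>) / sqrt (real n * (sqrt v)\<^sup>2))) (sqrt v) =
      (CLINT \<omega>|M. iexp ((\<Sum>j<n. W j \<omega>) / sqrt (real n)))" for n
    unfolding char_def using v0 by (subst integral_distr) (auto simp: real_sqrt_mult)
  ultimately show ?thesis using v0 by (simp add: char_std_normal_distribution)
qed

lemma iexp_diff_le: "cmod (iexp a - iexp b) \<le> \<bar>a - b\<bar>"
proof -
  have "iexp a - iexp b = iexp b * (iexp (a - b) - 1)"
    by (simp add: algebra_simps flip: exp_add)
  then have "cmod (iexp a - iexp b) = cmod (iexp (a - b) - 1)" by (simp add: norm_mult)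
  also have "\<dots> \<le> \<bar>a - b\<bar>" using iexp_approx1[of "a - b" 0] by simp
  finally show ?thesis .
qed

text \<open>Slutsky's lemma for characteristic functions: \<open>iexp\<close> is bounded and Lipschitz, so a perturbation that tends
  to \<open>0\<close> in probability does not change the limit.\<close>

lemma iexp_limit_unchanged_by_negligible:
  fixes T V :: "nat \<Rightarrow> 'a \<Rightarrow> 'b::euclidean_space"
  assumes [measurable]: "\<And>n. random_variable borel (T n)" "\<And>n. random_variable borel (V n)"
    and close: "\<And>\<delta>. \<delta> > 0 \<Longrightarrow> (\<lambda>n. prob {\<omega> \<in> space M. \<delta> < norm (T n \<omega> - V n \<omega>)}) \<longlonglongrightarrow> 0"
    and lim: "(\<lambda>n. CLINT \<omega>|M. iexp (t \<bullet> V n \<omega>)) \<longlonglongrightarrow> c"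
  shows "(\<lambda>n. CLINT \<omega>|M. iexp (t \<bullet> T n \<omega>)) \<longlonglongrightarrow> c"
proof -
  have "(\<lambda>n. (CLINT \<omega>|M. iexp (t \<bullet> T n \<omega>)) - (CLINT \<omega>|M. iexp (t \<bullet> V n \<omega>))) \<longlonglongrightarrow> 0"
  proof (rule tendstoI)
    fix \<epsilon> :: real assume "\<epsilon> > 0"
    define \<delta> where "\<delta> = \<epsilon> / (2 * (norm t + 1))"
    have \<delta>: "\<delta> > 0" using \<open>\<epsilon> > 0\<close> by (simp add: \<delta>_def add_nonneg_pos)
    have "norm t * \<delta> \<le> (norm t + 1) * \<delta>" using \<delta> by (intro mult_right_mono) auto
    also have "\<dots> = \<epsilon> / 2"
      using norm_ge_zero[of t] unfolding \<delta>_def by (simp add: add_nonneg_eq_0_iff del: distrib_left_numeral)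
    finally have t\<delta>: "norm t * \<delta> \<le> \<epsilon> / 2" .
    let ?B = "\<lambda>n. {\<omega> \<in> space M. \<delta> < norm (T n \<omega> - V n \<omega>)}"
    have int: "integrable M (\<lambda>\<omega>. iexp (f \<omega>))" if [measurable]: "random_variable borel f" for f
      by (rule integrable_const_bound[where B = 1]) auto
    have bound: "cmod ((CLINT \<omega>|M. iexp (t \<bullet> T n \<omega>)) - (CLINT \<omega>|M. iexp (t \<bullet> V n \<omega>))) \<le> \<epsilon> / 2 + 2 * prob (?B n)" for n
    proof -
      have "(CLINT \<omega>|M. iexp (t \<bullet> T n \<omega>)) - (CLINT \<omega>|M. iexp (t \<bullet> V n \<omega>)) =
          (CLINT \<omega>|M. iexp (t \<bullet> T n \<omega>) - iexp (t \<bullet> V n \<omega>))"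
        by (intro Bochner_Integration.integral_diff[symmetric] int) auto
      then have "cmod ((CLINT \<omega>|M. iexp (t \<bullet> T n \<omega>)) - (CLINT \<omega>|M. iexp (t \<bullet> V n \<omega>))) \<le>
          expectation (\<lambda>\<omega>. cmod (iexp (t \<bullet> T n \<omega>) - iexp (t \<bullet> V n \<omega>)))"
        by (simp only: integral_norm_bound)
      also have "\<dots> \<le> expectation (\<lambda>\<omega>. \<epsilon> / 2 + 2 * indicator (?B n) \<omega>)"
      proof (rule integral_mono)
        show "integrable M (\<lambda>\<omega>. cmod (iexp (t \<bullet> T n \<omega>) - iexp (t \<bullet> V n \<omega>)))"
          by (intro integrable_norm Bochner_Integration.integrable_diff int) auto
        show "integrable M (\<lambda>\<omega>. \<epsilon> / 2 + 2 * indicator (?B n) \<omega> :: real)"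
          by (intro Bochner_Integration.integrable_add integrable_const integrable_mult_right integrable_real_indicator)
             (auto simp: emeasure_eq_measure)
        fix \<omega> assume \<omega>: "\<omega> \<in> space M"
        show "cmod (iexp (t \<bullet> T n \<omega>) - iexp (t \<bullet> V n \<omega>)) \<le> \<epsilon> / 2 + 2 * indicator (?B n) \<omega>"
        proof (cases "\<omega> \<in> ?B n")
          case True
          have "cmod (iexp (t \<bullet> T n \<omega>) - iexp (t \<bullet> V n \<omega>)) \<le> 2"
            using norm_triangle_ineq4[of "iexp (t \<bullet> T n \<omega>)" "iexp (t \<bullet> V n \<omega>)"] by simp
          then show ?thesis using True \<open>\<epsilon> > 0\<close> by simp
        next
          case False
          have "cmod (iexp (t \<bullet> T n \<omega>) - iexp (t \<bullet> V n \<omega>)) \<le> \<bar>t \<bullet> (T n \<omega> - V n \<omega>)\<bar>"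
            using iexp_diff_le[of "t \<bullet> T n \<omega>" "t \<bullet> V n \<omega>"] by (simp only: inner_diff_right)
          also have "\<dots> \<le> norm t * norm (T n \<omega> - V n \<omega>)" by (rule Cauchy_Schwarz_ineq2)
          also have "\<dots> \<le> norm t * \<delta>" using False \<omega> by (intro mult_left_mono) auto
          also note t\<delta>
          finally show ?thesis using False by simp
        qed
      qed
      also have "\<dots> = \<epsilon> / 2 + 2 * prob (?B n)"
        by (subst Bochner_Integration.integral_add) (auto simp: emeasure_eq_measure prob_space)
      finally show ?thesis .
    qed
    have "\<forall>\<^sub>F n in sequentially. prob (?B n) < \<epsilon> / 4"
      using close[OF \<delta>] \<open>\<epsilon> > 0\<close> by (intro order_tendstoD) auto
    then show "\<forall>\<^sub>F n in sequentially. dist ((CLINT \<omega>|M. iexp (t \<bullet> T n \<omega>)) - (CLINT \<omega>|M. iexp (t \<bullet> V n \<omega>))) 0 < \<epsilon>"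
    proof eventually_elim
      case (elim n)
      then show ?case using bound[of n] by (simp only: dist_norm diff_0_right)
    qed
  qed
  from tendsto_add[OF this lim] show ?thesis by simp
qed

end

section \<open>Least squares in one group\<close>

lemma char_vec_distr:
  assumes [measurable]: "X \<in> borel_measurable M"
  shows "char_vec (distr M borel X) t = (CLINT \<omega>|M. iexp (t \<bullet> X \<omega>))"
  unfolding char_vec_def by (subst integral_distr) auto

text \<open>The law of \<open>A Z\<close> depends on \<open>A\<close> only through \<open>A A'\<close>, since the characteristic functional of \<open>Z\<close> depends only
  on the norm.\<close>

lemma char_vec_normal_image:
  fixes A :: "real^'p^'p"
  shows "char_vec (distr std_normal_vec borel (\<lambda>z. A *v z)) t =
         complex_of_real (exp (- (t \<bullet> ((A ** transpose A) *v t)) / 2))"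
proof -
  have [measurable]: "(\<lambda>z. A *v z) \<in> borel_measurable borel"
    by (intro borel_measurable_continuous_onI matrix_vector_mult_linear_continuous_on)
  have "char_vec (distr std_normal_vec borel (\<lambda>z. A *v z)) t = (CLINT z|std_normal_vec. iexp (t \<bullet> (A *v z)))"
    by (rule char_vec_distr) simp
  also have "\<dots> = char_vec std_normal_vec (transpose A *v t)"
    by (simp add: char_vec_def dot_lmul_matrix)
  also have "\<dots> = complex_of_real (exp (- (norm (transpose A *v t))\<^sup>2 / 2))"
    by (rule char_vec_std_normal)
  also have "(norm (transpose A *v t))\<^sup>2 = t \<bullet> ((A ** transpose A) *v t)"
    by (simp only: power2_norm_eq_inner matrix_vector_mul_assoc[symmetric] dot_lmul_matrix[symmetric] transpose_matrix_vector)
  finally show ?thesis .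
qed

lemma outer_square_mult_vector: "outer_square v *v w = (v \<bullet> w) *\<^sub>R v"
  by (simp add: vec_eq_iff outer_square_def matrix_vector_mult_def inner_vec_def sum_distrib_left mult_ac)

lemma inner_outer_square: "w \<bullet> (outer_square v *v w) = (v \<bullet> w)\<^sup>2"
  by (simp add: outer_square_mult_vector power2_eq_square inner_commute)

lemma borel_measurable_outer_square [measurable]: "outer_square \<in> borel_measurable borel"
  unfolding outer_square_def
  by (intro borel_measurable_continuous_onI continuous_on_vec_lambda continuous_intros)

lemma bounded_linear_inner_matrix_vector:
  "bounded_linear (\<lambda>S::real^'n^'m. w \<bullet> (S *v u))"
  by (auto simp: linear_conv_bounded_linear[symmetric] linear_iff matrix_vector_mult_add_rdistrib
      inner_add_right scaleR_matrix_vector_assoc[symmetric])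

text \<open>The criterion of one group is a quadratic polynomial in \<open>d\<close> whose coefficients are three sample means: the
  objects to which the laws of large numbers apply.\<close>

lemma mean_squared_residual_quadratic:
  fixes u :: "nat \<Rightarrow> real" and v :: "nat \<Rightarrow> real^'p"
  shows "1 / real n * (\<Sum>j<n. (u j - d \<bullet> v j)\<^sup>2) =
    (1 / real n) *\<^sub>R (\<Sum>j<n. (u j)\<^sup>2) - 2 * (d \<bullet> ((1 / real n) *\<^sub>R (\<Sum>j<n. u j *\<^sub>R v j))) +
    d \<bullet> (((1 / real n) *\<^sub>R (\<Sum>j<n. outer_square (v j))) *v d)"
proof -
  interpret bounded_linear "\<lambda>S. d \<bullet> (S *v d)" by (rule bounded_linear_inner_matrix_vector)
  have q: "d \<bullet> (((1 / real n) *\<^sub>R (\<Sum>j<n. outer_square (v j))) *v d) = 1 / real n * (\<Sum>j<n. (d \<bullet> v j)\<^sup>2)"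
    by (simp only: scale sum inner_outer_square inner_commute real_scaleR_def)
  have l: "d \<bullet> ((1 / real n) *\<^sub>R (\<Sum>j<n. u j *\<^sub>R v j)) = 1 / real n * (\<Sum>j<n. u j * (d \<bullet> v j))"
    by (simp only: inner_scaleR_right inner_sum_right)
  have "(\<Sum>j<n. (u j - d \<bullet> v j)\<^sup>2) = (\<Sum>j<n. (u j)\<^sup>2) - 2 * (\<Sum>j<n. u j * (d \<bullet> v j)) + (\<Sum>j<n. (d \<bullet> v j)\<^sup>2)"
    by (simp add: power2_diff sum.distrib sum_subtractf sum_distrib_left mult.assoc)
  then show ?thesis
    unfolding q l real_scaleR_def by (simp only: ring_distribs mult_ac)
qed

context prob_space begin

lemma independent_products:
  fixes A B :: "'a \<Rightarrow> real"
  assumes "independent_pair M borel A borel B" "integrable M A" "integrable M B"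
  shows "integrable M (\<lambda>\<omega>. A \<omega> * B \<omega>)" "expectation (\<lambda>\<omega>. A \<omega> * B \<omega>) = expectation A * expectation B"
  using independent_pair_imp_indep_var[OF assms(1)] assms(2,3)
  by (auto intro: indep_var_integrable indep_var_lebesgue_integral)

text \<open>The score \<open>E X\<close> is centred, and its covariance factorises because \<open>X\<close> and \<open>E\<close> are independent; in particular
  it has second moments as soon as \<open>X\<close> and \<open>E\<close> have them.\<close>

lemma noise_weighted_moments:
  fixes X :: "'a \<Rightarrow> real^'p" and E :: "'a \<Rightarrow> real"
  assumes XE: "independent_pair M borel X borel E"
    and X2: "integrable M (\<lambda>\<omega>. outer_square (X \<omega>))"
    and E2: "integrable M (\<lambda>\<omega>. (E \<omega>)\<^sup>2)" and mean: "expectation E = 0"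
  shows "integrable M (\<lambda>\<omega>. E \<omega> *\<^sub>R X \<omega>)" "expectation (\<lambda>\<omega>. E \<omega> *\<^sub>R X \<omega>) = 0"
    and "integrable M (\<lambda>\<omega>. (t \<bullet> (E \<omega> *\<^sub>R X \<omega>))\<^sup>2)"
    and "expectation (\<lambda>\<omega>. (t \<bullet> (E \<omega> *\<^sub>R X \<omega>))\<^sup>2) =
      expectation (\<lambda>\<omega>. (E \<omega>)\<^sup>2) * (t \<bullet> (expectation (\<lambda>\<omega>. outer_square (X \<omega>)) *v t))"
proof -
  have [measurable]: "random_variable borel X" "random_variable borel E"
    using XE by (auto simp: independent_pair_def)
  have sq: "integrable M (\<lambda>\<omega>. (X \<omega> \<bullet> t)\<^sup>2)"
    "expectation (\<lambda>\<omega>. (X \<omega> \<bullet> t)\<^sup>2) = t \<bullet> (expectation (\<lambda>\<omega>. outer_square (X \<omega>)) *v t)" for t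
    using integrable_bounded_linear[OF bounded_linear_inner_matrix_vector[of t t] X2]
      integral_bounded_linear[OF bounded_linear_inner_matrix_vector[of t t] X2]
    by (simp_all add: inner_outer_square)
  have X1: "integrable M (\<lambda>\<omega>. X \<omega> \<bullet> t)" for t
    using sq(1) by (rule square_integrable_imp_integrable[rotated]) simp
  have E1: "integrable M E"
    using E2 by (rule square_integrable_imp_integrable[rotated]) simp
  have ind1: "independent_pair M borel (\<lambda>\<omega>. X \<omega> \<bullet> t) borel E" for t
    by (rule independent_pair_compose[OF XE, where f = "\<lambda>v. v \<bullet> t" and g = "\<lambda>y. y"]) auto
  have ind2: "independent_pair M borel (\<lambda>\<omega>. (X \<omega> \<bullet> t)\<^sup>2) borel (\<lambda>\<omega>. (E \<omega>)\<^sup>2)" for t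
    by (rule independent_pair_compose[OF XE, where f = "\<lambda>v. (v \<bullet> t)\<^sup>2" and g = "\<lambda>y. y\<^sup>2"]) auto
  note p1 = independent_products[OF ind1 X1 E1] and p2 = independent_products[OF ind2 sq(1) E2]
  have rep: "E \<omega> *\<^sub>R X \<omega> = (\<Sum>b\<in>Basis. (X \<omega> \<bullet> b * E \<omega>) *\<^sub>R b)" for \<omega>
    by (subst euclidean_representation[of "X \<omega>", symmetric])
       (simp add: scaleR_sum_right mult.commute)
  show int: "integrable M (\<lambda>\<omega>. E \<omega> *\<^sub>R X \<omega>)"
    unfolding rep using p1 by (intro Bochner_Integration.integrable_sum integrable_scaleR_left) auto
  have "expectation (\<lambda>\<omega>. E \<omega> *\<^sub>R X \<omega>) \<bullet> b = 0" for b
    using integral_inner_left[OF int, of b] p1(2)[of b] mean by (simp add: mult.commute)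
  then show "expectation (\<lambda>\<omega>. E \<omega> *\<^sub>R X \<omega>) = 0"
    by (metis inner_eq_zero_iff)
  have eq: "(t \<bullet> (E \<omega> *\<^sub>R X \<omega>))\<^sup>2 = (X \<omega> \<bullet> t)\<^sup>2 * (E \<omega>)\<^sup>2" for \<omega>
    by (simp add: power_mult_distrib inner_commute mult.commute)
  show "integrable M (\<lambda>\<omega>. (t \<bullet> (E \<omega> *\<^sub>R X \<omega>))\<^sup>2)" unfolding eq by (rule p2)
  show "expectation (\<lambda>\<omega>. (t \<bullet> (E \<omega> *\<^sub>R X \<omega>))\<^sup>2) =
      expectation (\<lambda>\<omega>. (E \<omega>)\<^sup>2) * (t \<bullet> (expectation (\<lambda>\<omega>. outer_square (X \<omega>)) *v t))"
    unfolding eq p2(2) sq(2) by simp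
qed

end

text \<open>One group of observations. Its index set is all of \<open>nat\<close>; the samples of size \<open>n\<close> are the initial segments.
  The covariates are jointly independent of the errors, not just observation by observation: together
  with \<open>indep_vars_Pair\<close> this makes the pairs of covariate and error independent.\<close>

locale regression_sample = prob_space M for M :: "'w measure" +
  fixes X :: "nat \<Rightarrow> 'w \<Rightarrow> real^'p" and E :: "nat \<Rightarrow> 'w \<Rightarrow> real"
    and P :: "(real^'p) measure" and G :: "real measure"
  assumes X_indep: "indep_vars (\<lambda>_. borel) X UNIV" and X_distr: "\<And>j. distr M borel (X j) = P"
    and E_indep: "indep_vars (\<lambda>_. borel) E UNIV" and E_distr: "\<And>j. distr M borel (E j) = G"
    and X_E: "independent_pair M (Pi\<^sub>M UNIV (\<lambda>_. borel)) (\<lambda>\<omega>. \<lambda>j\<in>UNIV. X j \<omega>)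
                (Pi\<^sub>M UNIV (\<lambda>_. borel)) (\<lambda>\<omega>. \<lambda>j\<in>UNIV. E j \<omega>)"
    and outer_square_integrable: "integrable P outer_square"
    and square_integrable: "integrable G (\<lambda>y. y\<^sup>2)" and mean_zero: "(\<integral>y. y \<partial>G) = 0"
begin

abbreviation second_moment :: "real^'p^'p" where "second_moment \<equiv> \<integral>v. outer_square v \<partial>P"
abbreviation noise_variance :: real where "noise_variance \<equiv> \<integral>y. y\<^sup>2 \<partial>G"

lemma X_measurable [measurable]: "random_variable borel (X j)"
  and E_measurable [measurable]: "random_variable borel (E j)"
  using X_indep E_indep by (auto simp: indep_vars_def2)

lemma sets_P [measurable_cong]: "sets P = sets borel" and sets_G [measurable_cong]: "sets G = sets borel"
  using X_distr[of 0] E_distr[of 0] by auto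

lemma X_E_same_index: "independent_pair M borel (X j) borel (E j)"
  using independent_pair_compose[OF X_E, of "\<lambda>u. u j" borel "\<lambda>u. u j" borel] by simp

lemma moments:
  "integrable M (\<lambda>\<omega>. outer_square (X j \<omega>))" "expectation (\<lambda>\<omega>. outer_square (X j \<omega>)) = second_moment"
  "integrable M (\<lambda>\<omega>. (E j \<omega>)\<^sup>2)" "expectation (\<lambda>\<omega>. (E j \<omega>)\<^sup>2) = noise_variance"
  "expectation (E j) = 0"
proof -
  show "integrable M (\<lambda>\<omega>. outer_square (X j \<omega>))"
    using outer_square_integrable by (subst (asm) X_distr[of j, symmetric]) (simp add: integrable_distr_eq)
  show "integrable M (\<lambda>\<omega>. (E j \<omega>)\<^sup>2)"
    using square_integrable by (subst (asm) E_distr[of j, symmetric]) (simp add: integrable_distr_eq)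
  show "expectation (\<lambda>\<omega>. outer_square (X j \<omega>)) = second_moment"
    by (subst X_distr[of j, symmetric]) (simp add: integral_distr)
  show "expectation (\<lambda>\<omega>. (E j \<omega>)\<^sup>2) = noise_variance"
    by (subst E_distr[of j, symmetric]) (simp add: integral_distr)
  show "expectation (E j) = 0"
    using mean_zero by (subst (asm) E_distr[of j, symmetric]) (simp add: integral_distr)
qed

lemmas score_moments = noise_weighted_moments[OF X_E_same_index moments(1,3,5), unfolded moments(2,4)]

lemma score_indep: "indep_vars (\<lambda>_. borel) (\<lambda>j \<omega>. E j \<omega> *\<^sub>R X j \<omega>) UNIV"
proof -
  have "indep_vars (\<lambda>_. borel \<Otimes>\<^sub>M borel) (\<lambda>j \<omega>. (X j \<omega>, E j \<omega>)) UNIV"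
    by (rule indep_vars_Pair[OF X_indep E_indep X_E])
  from indep_vars_compose2[OF this, of "\<lambda>_ z. snd z *\<^sub>R fst z" "\<lambda>_. borel"] show ?thesis by simp
qed

lemma score_distr:
  "distr M borel (\<lambda>\<omega>. E j \<omega> *\<^sub>R X j \<omega>) = distr (P \<Otimes>\<^sub>M G) borel (\<lambda>z. snd z *\<^sub>R fst z)"
proof -
  have "distr M (borel \<Otimes>\<^sub>M borel) (\<lambda>\<omega>. (X j \<omega>, E j \<omega>)) = P \<Otimes>\<^sub>M G"
    using independent_pair_distr[OF X_E_same_index] by (simp only: X_distr E_distr)
  then have "distr (P \<Otimes>\<^sub>M G) borel (\<lambda>z. snd z *\<^sub>R fst z) =
      distr (distr M (borel \<Otimes>\<^sub>M borel) (\<lambda>\<omega>. (X j \<omega>, E j \<omega>))) borel (\<lambda>z. snd z *\<^sub>R fst z)" by simp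
  also have "\<dots> = distr M borel (\<lambda>\<omega>. E j \<omega> *\<^sub>R X j \<omega>)"
    by (subst distr_distr) (simp_all add: comp_def)
  finally show ?thesis ..
qed

lemma score_consistent:
  assumes "\<delta> > 0"
  shows "(\<lambda>n. prob {\<omega> \<in> space M. \<delta> \<le> norm ((1 / real n) *\<^sub>R (\<Sum>j<n. E j \<omega> *\<^sub>R X j \<omega>))}) \<longlonglongrightarrow> 0"
proof -
  let ?D = "distr M borel (\<lambda>\<omega>. E 0 \<omega> *\<^sub>R X 0 \<omega>)"
  have int: "integrable ?D (\<lambda>x. x)"
    using score_moments(1)[of 0] by (simp add: integrable_distr_eq)
  have zero: "(\<integral>x. x \<partial>?D) = 0"
    using score_moments(2)[of 0] by (simp add: integral_distr)
  have D: "distr M borel (\<lambda>\<omega>. E n \<omega> *\<^sub>R X n \<omega>) = ?D" for n by (simp only: score_distr)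
  show ?thesis
    using weak_law_large_numbers[OF score_indep D int assms] by (simp only: zero diff_0_right)
qed

lemma second_moment_consistent:
  assumes "\<delta> > 0"
  shows "(\<lambda>n. prob {\<omega> \<in> space M. \<delta> \<le> norm ((1 / real n) *\<^sub>R (\<Sum>j<n. outer_square (X j \<omega>)) - second_moment)}) \<longlonglongrightarrow> 0"
proof -
  let ?D = "distr P borel outer_square"
  have os: "outer_square \<in> borel_measurable P" by measurable
  have int: "integrable ?D (\<lambda>x. x)"
    using outer_square_integrable by (simp add: integrable_distr_eq[OF os])
  have mean: "(\<integral>x. x \<partial>?D) = second_moment" by (simp add: integral_distr[OF os])
  have D: "distr M borel (\<lambda>\<omega>. outer_square (X n \<omega>)) = ?D" for n
    by (simp only: X_distr[of n, symmetric], subst distr_distr) (simp_all add: comp_def)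
  have ind: "indep_vars (\<lambda>_. borel) (\<lambda>j \<omega>. outer_square (X j \<omega>)) UNIV"
    by (rule indep_vars_compose2[OF X_indep]) simp
  show ?thesis
    using weak_law_large_numbers[OF ind D int assms] by (simp only: mean)
qed

lemma noise_variance_consistent:
  assumes "\<delta> > 0"
  shows "(\<lambda>n. prob {\<omega> \<in> space M. \<delta> \<le> norm ((1 / real n) *\<^sub>R (\<Sum>j<n. (E j \<omega>)\<^sup>2) - noise_variance)}) \<longlonglongrightarrow> 0"
proof -
  let ?D = "distr G borel (\<lambda>y. y\<^sup>2)"
  have os: "(\<lambda>y. y\<^sup>2) \<in> borel_measurable G" by measurable
  have int: "integrable ?D (\<lambda>x. x)"
    using square_integrable by (simp add: integrable_distr_eq[OF os])
  have mean: "(\<integral>x. x \<partial>?D) = noise_variance" by (simp add: integral_distr[OF os])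
  have D: "distr M borel (\<lambda>\<omega>. (E n \<omega>)\<^sup>2) = ?D" for n
    by (simp only: E_distr[of n, symmetric], subst distr_distr) (simp_all add: comp_def)
  have ind: "indep_vars (\<lambda>_. borel) (\<lambda>j \<omega>. (E j \<omega>)\<^sup>2) UNIV"
    by (rule indep_vars_compose2[OF E_indep]) simp
  show ?thesis
    using weak_law_large_numbers[OF ind D int assms] by (simp only: mean)
qed

definition scaled_score :: "nat \<Rightarrow> 'w \<Rightarrow> real^'p" where
  "scaled_score n \<omega> = (1 / sqrt (real n)) *\<^sub>R (\<Sum>j<n. E j \<omega> *\<^sub>R X j \<omega>)"

lemma scaled_score_measurable [measurable]: "random_variable borel (scaled_score n)"
  unfolding scaled_score_def by measurable

lemma scaled_score_clt:
  "(\<lambda>n. CLINT \<omega>|M. iexp (t \<bullet> scaled_score n \<omega>)) \<longlonglongrightarrow>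
     complex_of_real (exp (- (noise_variance * (t \<bullet> (second_moment *v t))) / 2))"
proof -
  let ?W = "\<lambda>j \<omega>. t \<bullet> (E j \<omega> *\<^sub>R X j \<omega>)"
  have "(\<lambda>n. CLINT \<omega>|M. iexp ((\<Sum>j<n. ?W j \<omega>) / sqrt (real n))) \<longlonglongrightarrow>
     complex_of_real (exp (- (noise_variance * (t \<bullet> (second_moment *v t))) / 2))"
  proof (rule clt_iexp)
    show "indep_vars (\<lambda>_. borel) ?W UNIV" by (rule indep_vars_compose2[OF score_indep]) simp
    show "distr M borel (?W n) = distr (distr M borel (\<lambda>\<omega>. E 0 \<omega> *\<^sub>R X 0 \<omega>)) borel (\<lambda>v. t \<bullet> v)" for n
    proof -
      have "distr (distr M borel (\<lambda>\<omega>. E n \<omega> *\<^sub>R X n \<omega>)) borel (\<lambda>v. t \<bullet> v) = distr M borel (?W n)"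
        by (subst distr_distr) (simp_all add: comp_def)
      then show ?thesis by (simp only: score_distr)
    qed
    show "expectation (?W n) = 0" for n
      using score_moments(1,2)[of n] by (subst integral_inner_right) auto
  qed (rule score_moments)+
  then show ?thesis
    by (simp add: scaled_score_def inner_sum_right)
qed

text \<open>The second moment of \<open>scaled_score n\<close> is the same for all \<open>n > 0\<close>, so Chebyshev's inequality bounds the tails
  uniformly.\<close>

lemma scaled_score_tight:
  obtains C where "C \<ge> 0" "\<And>K n. K > 0 \<Longrightarrow> prob {\<omega> \<in> space M. K \<le> norm (scaled_score n \<omega>)} \<le> C / K\<^sup>2"
proof -
  let ?W = "\<lambda>b j \<omega>. b \<bullet> (E j \<omega> *\<^sub>R X j \<omega>)"
  define C where "C = (\<Sum>b\<in>Basis. noise_variance * (b \<bullet> (second_moment *v b)))"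
  have v: "noise_variance * (b \<bullet> (second_moment *v b)) \<ge> 0" for b
    unfolding score_moments(4)[of b 0, symmetric] by simp
  have C: "C \<ge> 0" unfolding C_def by (intro sum_nonneg v)
  have comp: "integrable M (\<lambda>\<omega>. (scaled_score n \<omega> \<bullet> b)\<^sup>2) \<and>
      expectation (\<lambda>\<omega>. (scaled_score n \<omega> \<bullet> b)\<^sup>2) \<le> noise_variance * (b \<bullet> (second_moment *v b))" for b n
  proof -
    have ind: "indep_vars (\<lambda>_. borel) (?W b) {..<n}"
      by (rule indep_vars_subset[OF indep_vars_compose2[OF score_indep]]) simp_all
    have mean: "expectation (?W b j) = 0" for j
      using score_moments(1,2)[of j] by (subst integral_inner_right) auto
    note S = expectation_square_sum_indep[OF finite_lessThan ind score_moments(3) mean]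
    have eq: "(scaled_score n \<omega> \<bullet> b)\<^sup>2 = 1 / real n * (\<Sum>j<n. ?W b j \<omega>)\<^sup>2" for \<omega>
      by (simp add: scaled_score_def inner_commute[of _ b] inner_sum_right power_divide)
    have "expectation (\<lambda>\<omega>. (\<Sum>j<n. ?W b j \<omega>)\<^sup>2) = real n * (noise_variance * (b \<bullet> (second_moment *v b)))"
      by (simp only: S(2) score_moments(4) sum_constant card_lessThan)
    then have "expectation (\<lambda>\<omega>. 1 / real n * (\<Sum>j<n. ?W b j \<omega>)\<^sup>2) \<le>
        noise_variance * (b \<bullet> (second_moment *v b))"
      using v[of b] by (simp only: integral_mult_right_zero) (cases "n = 0"; simp)
    moreover have "integrable M (\<lambda>\<omega>. 1 / real n * (\<Sum>j<n. ?W b j \<omega>)\<^sup>2)"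
      by (intro integrable_mult_right S(1))
    ultimately show ?thesis unfolding eq by blast
  qed
  show thesis
  proof (rule that[OF C])
    fix K :: real and n assume K: "K > 0"
    have nsq: "(norm (scaled_score n \<omega>))\<^sup>2 = (\<Sum>b\<in>Basis. (scaled_score n \<omega> \<bullet> b)\<^sup>2)" for \<omega>
      by (subst power2_norm_eq_inner, subst euclidean_inner) (simp add: power2_eq_square)
    have int: "integrable M (\<lambda>\<omega>. (norm (scaled_score n \<omega>))\<^sup>2)"
      unfolding nsq using comp by (intro Bochner_Integration.integrable_sum) auto
    have "{\<omega> \<in> space M. K \<le> norm (scaled_score n \<omega>)} = {\<omega> \<in> space M. K\<^sup>2 \<le> (norm (scaled_score n \<omega>))\<^sup>2}"
      using K by auto
    then have "prob {\<omega> \<in> space M. K \<le> norm (scaled_score n \<omega>)} \<le> expectation (\<lambda>\<omega>. (norm (scaled_score n \<omega>))\<^sup>2) / K\<^sup>2"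
      using integral_Markov_inequality_measure[OF int, of "{}" "K\<^sup>2"] K by simp
    also have "expectation (\<lambda>\<omega>. (norm (scaled_score n \<omega>))\<^sup>2) \<le> C"
      unfolding nsq C_def using comp
      by (subst Bochner_Integration.integral_sum) (auto intro!: sum_mono)
    finally show "prob {\<omega> \<in> space M. K \<le> norm (scaled_score n \<omega>)} \<le> C / K\<^sup>2"
      using K by (simp add: divide_right_mono)
  qed
qed

end

section \<open>The minimizer of the maximal group criterion\<close>

context prob_space begin

text \<open>Outside an event \<open>bad n \<delta>\<close> of vanishing probability the sample means of all groups are \<open>\<delta>\<close>-close to
  their limits, and then the minimizer \<open>d n\<close> solves the normal equation of group \<open>k\<close>. Hence
  \<open>T n = sqrt n * d n\<close> solves a linear system with right-hand side \<open>scaled_score n\<close> and a matrix close to \<open>Sg\<close>. It is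
  compared with \<open>V n\<close>, which solves the system with the matrix \<open>Sg\<close> itself: \<open>V n\<close> is a
  fixed linear image of the score and its characteristic function converges by the central limit theorem,
  while \<open>T n - V n\<close> is at most a constant times \<open>\<delta> * norm (scaled_score n)\<close> and is negligible by
  tightness. The errors of different groups may depend on one another, so their exceptional events are
  combined by a union bound.\<close>

lemma max_criterion_minimizer_iexp_limit:
  fixes X :: "'i \<Rightarrow> nat \<Rightarrow> 'a \<Rightarrow> real^'p" and E :: "'i \<Rightarrow> nat \<Rightarrow> 'a \<Rightarrow> real"
    and P :: "(real^'p) measure" and G :: "'i \<Rightarrow> real measure" and d :: "nat \<Rightarrow> 'a \<Rightarrow> real^'p"
  defines "v \<equiv> \<lambda>i. \<integral>y. y\<^sup>2 \<partial>G i" and "Sg \<equiv> \<integral>v. outer_square v \<partial>P"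
  assumes fin: "finite I" and k: "k \<in> I"
    and rows: "\<And>i. i \<in> I \<Longrightarrow> regression_sample M (X i) (E i) P (G i)"
    and pd: "positive_definite Sg"
    and gap: "\<And>i. i \<in> I \<Longrightarrow> i \<noteq> k \<Longrightarrow> v i < v k"
    and d_meas [measurable]: "\<And>n. random_variable borel (d n)"
    and argmin: "\<And>n \<omega>. n > 0 \<Longrightarrow> \<omega> \<in> space M \<Longrightarrow>
      is_arg_min (\<lambda>b. MAX i\<in>I. 1 / real n * (\<Sum>j<n. (E i j \<omega> - b \<bullet> X i j \<omega>)\<^sup>2)) (\<lambda>_. True) (d n \<omega>)"
  shows "(\<lambda>n. CLINT \<omega>|M. iexp (t \<bullet> (sqrt (real n) *\<^sub>R d n \<omega>))) \<longlonglongrightarrow>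
     complex_of_real (exp (- (v k * (t \<bullet> (matrix_inv Sg *v t))) / 2))"
proof -
  interpret K: regression_sample M "X k" "E k" P "G k" by (rule rows[OF k])
  obtain c where c: "c > 0" "\<And>w. c * (norm w)\<^sup>2 \<le> w \<bullet> (Sg *v w)"
    using positive_definite_coercive[OF pd] by blast
  define Q where "Q = matrix_inv Sg"
  obtain U :: "real^'p^'p" where U: "U ** transpose U = Q" and SQ: "Sg ** Q = mat 1"
    using positive_definite_inverse_factor[OF pd] unfolding Q_def by blast
  have Q_sym: "transpose Q = Q"
    by (simp only: U[symmetric] matrix_transpose_mul transpose_transpose)
  define s where "s n \<omega> i = (1 / real n) *\<^sub>R (\<Sum>j<n. (E i j \<omega>)\<^sup>2)" for n \<omega> i
  define g where "g n \<omega> i = (1 / real n) *\<^sub>R (\<Sum>j<n. E i j \<omega> *\<^sub>R X i j \<omega>)" for n \<omega> i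
  define S where "S n \<omega> i = (1 / real n) *\<^sub>R (\<Sum>j<n. outer_square (X i j \<omega>))" for n \<omega> i
  obtain \<delta>0 where \<delta>0: "\<delta>0 > 0" and normal_eq:
    "\<forall>s g S d. (\<forall>i\<in>I. \<bar>s i - v i\<bar> \<le> \<delta>0 \<and> norm (g i) \<le> \<delta>0 \<and> norm (S i - Sg) \<le> \<delta>0) \<longrightarrow>
       transpose (S k) = S k \<longrightarrow>
       is_arg_min (\<lambda>d. MAX i\<in>I. s i - 2 * (d \<bullet> g i) + d \<bullet> (S i *v d)) (\<lambda>_. True) d \<longrightarrow>
       S k *v d = g k"
    using minimizer_of_max_of_quadratics[where v = v, OF fin k pd gap] by blast
  define bad where "bad n \<delta> = (\<Union>i\<in>I. {\<omega> \<in> space M. \<delta> \<le> norm (s n \<omega> i - v i)} \<union>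
      {\<omega> \<in> space M. \<delta> \<le> norm (g n \<omega> i)} \<union> {\<omega> \<in> space M. \<delta> \<le> norm (S n \<omega> i - Sg)})" for n \<delta>
  have meas: "{\<omega> \<in> space M. \<delta> \<le> norm (s n \<omega> i - v i)} \<in> events"
    "{\<omega> \<in> space M. \<delta> \<le> norm (g n \<omega> i)} \<in> events"
    "{\<omega> \<in> space M. \<delta> \<le> norm (S n \<omega> i - Sg)} \<in> events" if "i \<in> I" for i n \<delta>
  proof -
    interpret R: regression_sample M "X i" "E i" P "G i" by (rule rows[OF that])
    show "{\<omega> \<in> space M. \<delta> \<le> norm (s n \<omega> i - v i)} \<in> events"
      "{\<omega> \<in> space M. \<delta> \<le> norm (g n \<omega> i)} \<in> events"
      "{\<omega> \<in> space M. \<delta> \<le> norm (S n \<omega> i - Sg)} \<in> events"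
      unfolding s_def g_def S_def by measurable
  qed
  have bad_events [measurable]: "bad n \<delta> \<in> events" for n \<delta>
    unfolding bad_def using fin meas by (intro sets.finite_UN sets.Un) auto
  have bad_lim: "(\<lambda>n. prob (bad n \<delta>)) \<longlonglongrightarrow> 0" if \<delta>: "\<delta> > 0" for \<delta>
  proof -
    let ?p = "\<lambda>n i. prob {\<omega> \<in> space M. \<delta> \<le> norm (s n \<omega> i - v i)} +
        prob {\<omega> \<in> space M. \<delta> \<le> norm (g n \<omega> i)} + prob {\<omega> \<in> space M. \<delta> \<le> norm (S n \<omega> i - Sg)}"
    have "(\<lambda>n. ?p n i) \<longlonglongrightarrow> 0 + 0 + 0" if "i \<in> I" for i
    proof -
      interpret R: regression_sample M "X i" "E i" P "G i" by (rule rows[OF that])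
      show ?thesis
        unfolding s_def g_def S_def v_def Sg_def
        by (intro tendsto_add R.noise_variance_consistent R.score_consistent R.second_moment_consistent \<delta>)
    qed
    then have "(\<lambda>n. \<Sum>i\<in>I. ?p n i) \<longlonglongrightarrow> (\<Sum>i\<in>I. 0)"
      by (intro tendsto_sum) auto
    then have lim: "(\<lambda>n. \<Sum>i\<in>I. ?p n i) \<longlonglongrightarrow> 0" by simp
    have le: "prob (bad n \<delta>) \<le> (\<Sum>i\<in>I. ?p n i)" for n
    proof -
      have "prob (bad n \<delta>) \<le> (\<Sum>i\<in>I. prob ({\<omega> \<in> space M. \<delta> \<le> norm (s n \<omega> i - v i)} \<union>
          {\<omega> \<in> space M. \<delta> \<le> norm (g n \<omega> i)} \<union> {\<omega> \<in> space M. \<delta> \<le> norm (S n \<omega> i - Sg)}))"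
        unfolding bad_def using fin meas by (intro finite_measure_subadditive_finite) auto
      also have "\<dots> \<le> (\<Sum>i\<in>I. ?p n i)"
      proof (rule sum_mono)
        fix i assume i: "i \<in> I"
        show "prob ({\<omega> \<in> space M. \<delta> \<le> norm (s n \<omega> i - v i)} \<union>
          {\<omega> \<in> space M. \<delta> \<le> norm (g n \<omega> i)} \<union> {\<omega> \<in> space M. \<delta> \<le> norm (S n \<omega> i - Sg)}) \<le> ?p n i"
          (is "prob (?A \<union> ?B \<union> ?C) \<le> _")
        proof -
          have ev: "?A \<in> events" "?B \<in> events" "?C \<in> events" by (rule meas[OF i])+
          show ?thesis
            using measure_Un_le[OF sets.Un[OF ev(1,2)] ev(3)] measure_Un_le[OF ev(1,2)]
            by linarith
        qed
      qed
      finally show ?thesis .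
    qed
    show ?thesis by (rule tendsto_sandwich[OF _ _ tendsto_const lim]) (simp, intro always_eventually allI le)
  qed
  define T where "T n \<omega> = sqrt (real n) *\<^sub>R d n \<omega>" for n \<omega>
  define V where "V n \<omega> = Q *v K.scaled_score n \<omega>" for n \<omega>
  have QV: "Sg *v V n \<omega> = K.scaled_score n \<omega>" for n \<omega>
    by (simp only: V_def matrix_vector_mul_assoc SQ matrix_vector_mul_lid)
  have [measurable]: "random_variable borel (T n)" for n unfolding T_def by measurable
  have [measurable]: "random_variable borel (V n)" for n
  proof -
    have [measurable]: "(\<lambda>z. Q *v z) \<in> borel_measurable borel"
      by (intro borel_measurable_continuous_onI matrix_vector_mult_linear_continuous_on)
    show ?thesis unfolding V_def by measurable
  qed
  have TV: "norm (T n \<omega> - V n \<omega>) \<le> 2 * \<delta> / c\<^sup>2 * norm (K.scaled_score n \<omega>)"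
    if \<omega>: "\<omega> \<in> space M" "\<omega> \<notin> bad n \<delta>" and n: "n > 0" and \<delta>: "\<delta> \<le> \<delta>0" "\<delta> \<le> c / 2" for n \<omega> \<delta>
  proof -
    have near: "\<bar>s n \<omega> i - v i\<bar> \<le> \<delta>" "norm (g n \<omega> i) \<le> \<delta>" "norm (S n \<omega> i - Sg) \<le> \<delta>" if "i \<in> I" for i
      using \<omega> that by (auto simp: bad_def)
    have "S n \<omega> k *v d n \<omega> = g n \<omega> k"
    proof (rule normal_eq[rule_format])
      show "\<bar>s n \<omega> i - v i\<bar> \<le> \<delta>0 \<and> norm (g n \<omega> i) \<le> \<delta>0 \<and> norm (S n \<omega> i - Sg) \<le> \<delta>0" if "i \<in> I" for i
        using near[OF that] \<delta>(1) by auto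
      have "outer_square w $ a $ b = outer_square w $ b $ a" for w :: "real^'p" and a b
        by (simp add: outer_square_def mult.commute)
      then show "transpose (S n \<omega> k) = S n \<omega> k"
        by (simp add: vec_eq_iff S_def transpose_def)
      show "is_arg_min (\<lambda>d. MAX i\<in>I. s n \<omega> i - 2 * (d \<bullet> g n \<omega> i) + d \<bullet> (S n \<omega> i *v d)) (\<lambda>_. True) (d n \<omega>)"
        using argmin[OF n \<omega>(1)] unfolding mean_squared_residual_quadratic s_def g_def S_def .
    qed
    then have "S n \<omega> k *v T n \<omega> = sqrt (real n) *\<^sub>R g n \<omega> k"
      by (simp add: T_def matrix_vector_mult_scaleR)
    also have "sqrt (real n) *\<^sub>R g n \<omega> k = K.scaled_score n \<omega>"
    proof -
      have "sqrt (real n) * (1 / real n) = 1 / sqrt (real n)"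
        using n by (simp add: sqrt_divide_self_eq inverse_eq_divide)
      then show ?thesis by (simp only: g_def K.scaled_score_def scaleR_scaleR)
    qed
    finally show ?thesis
      by (intro solution_perturbation[OF c near(3)[OF k] \<delta>(2) _ QV])
  qed
  have close: "(\<lambda>n. prob {\<omega> \<in> space M. \<eta> < norm (T n \<omega> - V n \<omega>)}) \<longlonglongrightarrow> 0" if \<eta>: "\<eta> > 0" for \<eta>
  proof (rule tendstoI)
    fix \<epsilon> :: real assume \<epsilon>: "\<epsilon> > 0"
    obtain C where C: "C \<ge> 0" "\<And>K n. K > 0 \<Longrightarrow> prob {\<omega> \<in> space M. K \<le> norm (K.scaled_score n \<omega>)} \<le> C / K\<^sup>2"
      using K.scaled_score_tight by blast
    \<comment> \<open>\<open>K\<close> is chosen so that the score exceeds it with probability less than \<open>\<epsilon> / 2\<close>; adding \<open>1\<close> to \<open>C\<close> keeps \<open>K\<close>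
       positive.\<close>
    define K where "K = sqrt (2 * (C + 1) / \<epsilon>)"
    have K: "K > 0" using C(1) \<epsilon> by (simp add: K_def)
    have "K\<^sup>2 = 2 * (C + 1) / \<epsilon>" using C(1) \<epsilon> by (simp add: K_def)
    then have CK: "C / K\<^sup>2 < \<epsilon> / 2" using C(1) \<epsilon> K by (simp add: field_simps)
    \<comment> \<open>The last bound on \<open>\<delta>\<close> makes \<open>2 * \<delta> / c\<^sup>2 * K \<le> \<eta>\<close>.\<close>
    define \<delta> where "\<delta> = Min {\<delta>0, c / 2, \<eta> * c\<^sup>2 / (2 * K)}"
    have \<delta>: "\<delta> > 0" using \<delta>0 c(1) \<eta> K by (simp add: \<delta>_def)
    have \<delta>_le: "\<delta> \<le> \<delta>0" "\<delta> \<le> c / 2" "\<delta> \<le> \<eta> * c\<^sup>2 / (2 * K)"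
      unfolding \<delta>_def by (rule Min_le; simp)+
    have sub: "{\<omega> \<in> space M. \<eta> < norm (T n \<omega> - V n \<omega>)} \<subseteq> bad n \<delta> \<union> {\<omega> \<in> space M. K \<le> norm (K.scaled_score n \<omega>)}"
      if n: "n > 0" for n
    proof (rule subsetI, rule ccontr)
      fix \<omega> assume a: "\<omega> \<in> {\<omega> \<in> space M. \<eta> < norm (T n \<omega> - V n \<omega>)}"
        and b: "\<omega> \<notin> bad n \<delta> \<union> {\<omega> \<in> space M. K \<le> norm (K.scaled_score n \<omega>)}"
      then have "norm (T n \<omega> - V n \<omega>) \<le> 2 * \<delta> / c\<^sup>2 * norm (K.scaled_score n \<omega>)"
        using n \<delta>_le by (intro TV) auto
      also have "\<dots> \<le> 2 * \<delta> / c\<^sup>2 * K" using a b \<delta> by (intro mult_left_mono) auto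
      also have "\<dots> \<le> \<eta>" using \<delta>_le(3) K c(1) by (simp add: field_simps)
      finally show False using a by simp
    qed
    have "\<forall>\<^sub>F n in sequentially. prob (bad n \<delta>) < \<epsilon> / 2"
      using bad_lim[OF \<delta>] by (rule order_tendstoD) (use \<epsilon> in simp)
    then show "\<forall>\<^sub>F n in sequentially. dist (prob {\<omega> \<in> space M. \<eta> < norm (T n \<omega> - V n \<omega>)}) 0 < \<epsilon>"
      using eventually_gt_at_top[of "0::nat"]
    proof eventually_elim
      case (elim n)
      have "prob {\<omega> \<in> space M. \<eta> < norm (T n \<omega> - V n \<omega>)} \<le>
          prob (bad n \<delta> \<union> {\<omega> \<in> space M. K \<le> norm (K.scaled_score n \<omega>)})"
        by (intro finite_measure_mono sub elim) measurable
      also have "\<dots> \<le> prob (bad n \<delta>) + prob {\<omega> \<in> space M. K \<le> norm (K.scaled_score n \<omega>)}"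
        by (rule measure_Un_le) measurable
      also have "\<dots> < \<epsilon>" using elim(1) C(2)[OF K, of n] CK by linarith
      finally show ?case by simp
    qed
  qed
  have "(\<lambda>n. CLINT \<omega>|M. iexp (t \<bullet> V n \<omega>)) \<longlonglongrightarrow>
      complex_of_real (exp (- (v k * (t \<bullet> (Q *v t))) / 2))"
  proof -
    have "t \<bullet> V n \<omega> = (Q *v t) \<bullet> K.scaled_score n \<omega>" for n \<omega>
      unfolding V_def by (subst inner_symmetric_matrix[OF Q_sym]) (rule inner_commute)
    moreover have "(Q *v t) \<bullet> (Sg *v (Q *v t)) = t \<bullet> (Q *v t)"
      by (simp only: matrix_vector_mul_assoc SQ matrix_vector_mul_lid inner_commute)
    ultimately show ?thesis
      using K.scaled_score_clt[of "Q *v t"] by (simp only: v_def Sg_def[symmetric])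
  qed
  from iexp_limit_unchanged_by_negligible[OF _ _ close this]
  show ?thesis unfolding T_def Q_def by simp
qed

end

lemma is_arg_min_shift:
  fixes b :: "'a::ab_group_add"
  assumes "is_arg_min f (\<lambda>_. True) b"
  shows "is_arg_min (\<lambda>d. f (d + \<beta>)) (\<lambda>_. True) (b - \<beta>)"
  using assms by (simp add: is_arg_min_def)

lemma max_group_mse_reparametrized:
  assumes "\<And>i j. i \<in> {1..m} \<Longrightarrow> 1 \<le> j \<Longrightarrow> y i j = \<beta> \<bullet> x i j + e i j"
  shows "max_group_mse m n y x (d + \<beta>) =
    (MAX i\<in>{1..m}. 1 / real n * (\<Sum>j<n. (e i (Suc j) - d \<bullet> x i (Suc j))\<^sup>2))"
  unfolding max_group_mse_def
proof (rule arg_cong[where f = Max], rule image_cong[OF refl])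
  fix i assume i: "i \<in> {1..m}"
  have "(\<Sum>j = 1..n. (y i j - (d + \<beta>) \<bullet> x i j)\<^sup>2) = (\<Sum>j = 1..n. (e i j - d \<bullet> x i j)\<^sup>2)"
    using assms[OF i] by (intro sum.cong) (auto simp: inner_add_left)
  also have "\<dots> = (\<Sum>j<n. (e i (Suc j) - d \<bullet> x i (Suc j))\<^sup>2)"
    by (simp add: sum.atLeast1_atMost_eq)
  finally show "1 / real n * (\<Sum>j = 1..n. (y i j - (d + \<beta>) \<bullet> x i j)\<^sup>2) =
    1 / real n * (\<Sum>j<n. (e i (Suc j) - d \<bullet> x i (Suc j))\<^sup>2)" by simp
qed

text \<open>A maximum of the means \<open>\<integral>y. y \<partial>F i\<close> that is \<open>0\<close> together with a maximum of the \<open>\<integral>y. - y \<partial>F i\<close> that is \<open>0\<close> leaves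
  mean zero for every \<open>F i\<close>.\<close>

lemma represented_moments:
  assumes sub: "sublinear_expectation_space H EE" and eps: "\<epsilon> \<in> H" and sq: "(\<lambda>\<omega>. (\<epsilon> \<omega>)\<^sup>2) \<in> H"
    and mc: "mean_certain_zero EE \<epsilon>" and rep: "represented_by H EE \<epsilon> m F" and i: "i \<in> {1..m}"
  shows "integrable (F i) (\<lambda>y. y\<^sup>2)" "(\<integral>y. y \<partial>F i) = 0"
proof -
  interpret sublinear_expectation_space H EE by fact
  have rep': "(\<forall>i\<in>{1..m}. integrable (F i) g) \<and> EE (\<lambda>\<omega>. g (\<epsilon> \<omega>)) = (MAX i\<in>{1..m}. (\<integral>y. g y \<partial>F i))"
    if "g \<in> borel_measurable borel" "(\<lambda>\<omega>. g (\<epsilon> \<omega>)) \<in> H" for g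
    using rep that unfolding represented_by_def by blast
  show "integrable (F i) (\<lambda>y. y\<^sup>2)"
    using rep'[of "\<lambda>y. y\<^sup>2"] sq i by auto
  have le: "(\<integral>y. g y \<partial>F i) \<le> EE (\<lambda>\<omega>. g (\<epsilon> \<omega>))"
    if "g \<in> borel_measurable borel" "(\<lambda>\<omega>. g (\<epsilon> \<omega>)) \<in> H" for g
    using rep'[OF that] i by simp
  have "(\<lambda>\<omega>. - \<epsilon> \<omega>) \<in> H" using H_scale[OF eps, of "-1"] by simp
  then have "(\<integral>y. - y \<partial>F i) \<le> 0" using le[of "\<lambda>y. - y"] mc by (simp add: mean_certain_zero_def)
  moreover have "(\<integral>y. y \<partial>F i) \<le> 0" using le[of "\<lambda>y. y"] eps mc by (simp add: mean_certain_zero_def)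
  ultimately show "(\<integral>y. y \<partial>F i) = 0" by simp
qed

theorem theorem3p1:
  fixes H :: "('o \<Rightarrow> real) set" and EE :: "('o \<Rightarrow> real) \<Rightarrow> real" and \<epsilon> :: "'o \<Rightarrow> real"
    and m :: nat and F :: "nat \<Rightarrow> real measure"
    and M :: "'w measure" and Fx :: "(real^'p) measure"
    and x :: "nat \<Rightarrow> nat \<Rightarrow> 'w \<Rightarrow> real^'p"
    and e Y :: "nat \<Rightarrow> nat \<Rightarrow> 'w \<Rightarrow> real"
    and \<beta> :: "real^'p" and \<sigma> :: "nat \<Rightarrow> real" and istar :: nat
    and \<beta>hat :: "nat \<Rightarrow> 'w \<Rightarrow> real^'p"
  assumes sublinear: "sublinear_expectation_space H EE"
    and linear_in_H: "\<epsilon> \<in> H"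
    and quadratic_in_H: "(\<lambda>\<omega>. (\<epsilon> \<omega>)\<^sup>2) \<in> H"
    and mean_certainty: "mean_certain_zero EE \<epsilon>"
    and representation: "represented_by H EE \<epsilon> m F"
    and prob: "prob_space M"
    and x_indep: "prob_space.indep_vars M (\<lambda>_. borel) (\<lambda>(i, j). x i j) ({1..m} \<times> {1..})"
    and x_distr: "\<And>i j. i \<in> {1..m} \<Longrightarrow> 1 \<le> j \<Longrightarrow> distr M borel (x i j) = Fx"
    and e_indep: "\<And>i. i \<in> {1..m} \<Longrightarrow> prob_space.indep_vars M (\<lambda>_. borel) (e i) {1..}"
    and e_distr: "\<And>i j. i \<in> {1..m} \<Longrightarrow> 1 \<le> j \<Longrightarrow> distr M borel (e i j) = F i"
    and x_e_indep: "independent_pair M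
          (Pi\<^sub>M ({1..m} \<times> {1..}) (\<lambda>_. borel)) (\<lambda>\<omega>. \<lambda>(i, j)\<in>{1..m} \<times> {1..}. x i j \<omega>)
          (Pi\<^sub>M ({1..m} \<times> {1..}) (\<lambda>_. borel)) (\<lambda>\<omega>. \<lambda>(i, j)\<in>{1..m} \<times> {1..}. e i j \<omega>)"
    and model: "\<And>i j \<omega>. i \<in> {1..m} \<Longrightarrow> 1 \<le> j \<Longrightarrow> \<omega> \<in> space M \<Longrightarrow>
          Y i j \<omega> = \<beta> \<bullet> x i j \<omega> + e i j \<omega>"
    and variances: "\<And>i j. i \<in> {1..m} \<Longrightarrow> 1 \<le> j \<Longrightarrow>
          (\<sigma> i)\<^sup>2 = prob_space.expectation M (\<lambda>\<omega>. (e i j \<omega>)\<^sup>2)"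
    and istar: "istar \<in> {1..m}" "(\<sigma> istar)\<^sup>2 = (MAX i\<in>{1..m}. (\<sigma> i)\<^sup>2)"
    and istar_strict: "\<And>i. i \<in> {1..m} \<Longrightarrow> i \<noteq> istar \<Longrightarrow> (\<sigma> istar)\<^sup>2 > (\<sigma> i)\<^sup>2"
    and \<beta>hat_measurable: "\<And>n. \<beta>hat n \<in> borel_measurable M"
    and \<beta>hat_argmin: "\<And>n \<omega>. 1 \<le> n \<Longrightarrow> \<omega> \<in> space M \<Longrightarrow>
          is_arg_min (max_group_mse m n (\<lambda>i j. Y i j \<omega>) (\<lambda>i j. x i j \<omega>)) (\<lambda>_. True) (\<beta>hat n \<omega>)"
    and xx_integrable: "integrable Fx outer_square"
    and xx_pos_def: "positive_definite (\<integral>v. outer_square v \<partial>Fx)"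
  shows "\<exists>L. is_normal_law 0 ((\<sigma> istar)\<^sup>2 *\<^sub>R matrix_inv (\<integral>v. outer_square v \<partial>Fx)) L \<and>
           converges_in_distribution M (\<lambda>n \<omega>. sqrt (real n) *\<^sub>R (\<beta>hat n \<omega> - \<beta>)) L"
proof -
  interpret prob_space M by (rule prob)
  define I where "I = {1..m}"
  define Sg where "Sg = (\<integral>v. outer_square v \<partial>Fx)"
  \<comment> \<open>Observation \<open>j\<close> of a group, counted from \<open>1\<close>, becomes index \<open>j - 1\<close> of a \<open>regression_sample\<close>.\<close>
  have rows: "regression_sample M (\<lambda>j. x i (Suc j)) (\<lambda>j. e i (Suc j)) Fx (F i)" if i: "i \<in> I" for i
  proof
    have i: "i \<in> {1..m}" using that by (simp add: I_def)
    let ?K = "{1..m} \<times> {1::nat..}"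
    have "indep_vars (\<lambda>_. borel) (\<lambda>(i, j). x i j) ((\<lambda>j. (i, Suc j)) ` UNIV)"
      by (rule indep_vars_subset[OF x_indep]) (use i in auto)
    from indep_vars_reindex[OF _ this] show "indep_vars (\<lambda>_. borel) (\<lambda>j. x i (Suc j)) UNIV"
      by (simp add: inj_on_def)
    have "indep_vars (\<lambda>_. borel) (e i) (Suc ` UNIV)"
      by (rule indep_vars_subset[OF e_indep[OF i]]) auto
    from indep_vars_reindex[OF _ this] show "indep_vars (\<lambda>_. borel) (\<lambda>j. e i (Suc j)) UNIV"
      by simp
    have "(\<lambda>u. \<lambda>j\<in>UNIV. u (i, Suc j)) \<in> measurable (Pi\<^sub>M ?K (\<lambda>_. borel :: (real^'p) measure)) (Pi\<^sub>M UNIV (\<lambda>_. borel))"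
      "(\<lambda>u. \<lambda>j\<in>UNIV. u (i, Suc j)) \<in> measurable (Pi\<^sub>M ?K (\<lambda>_. borel :: real measure)) (Pi\<^sub>M UNIV (\<lambda>_. borel))"
      using i by (auto intro!: measurable_restrict measurable_component_singleton)
    from independent_pair_compose[OF x_e_indep this]
    show "independent_pair M (Pi\<^sub>M UNIV (\<lambda>_. borel)) (\<lambda>\<omega>. \<lambda>j\<in>UNIV. x i (Suc j) \<omega>)
        (Pi\<^sub>M UNIV (\<lambda>_. borel)) (\<lambda>\<omega>. \<lambda>j\<in>UNIV. e i (Suc j) \<omega>)"
      using i by simp
    show "distr M borel (x i (Suc j)) = Fx" "distr M borel (e i (Suc j)) = F i" for j
      using x_distr[OF i, of "Suc j"] e_distr[OF i, of "Suc j"] by auto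
    show "integrable Fx outer_square" by (rule xx_integrable)
    show "integrable (F i) (\<lambda>y. y\<^sup>2)" "(\<integral>y. y \<partial>F i) = 0"
      by (rule represented_moments[OF sublinear linear_in_H quadratic_in_H mean_certainty representation i])+
  qed
  have var: "(\<sigma> i)\<^sup>2 = (\<integral>y. y\<^sup>2 \<partial>F i)" if i: "i \<in> I" for i
  proof -
    interpret R: regression_sample M "\<lambda>j. x i (Suc j)" "\<lambda>j. e i (Suc j)" Fx "F i" by (rule rows[OF i])
    show ?thesis using variances[of i "Suc 0"] R.moments(4)[of 0] i by (simp add: I_def)
  qed
  have k: "istar \<in> I" using istar by (simp add: I_def)
  have lim: "(\<lambda>n. CLINT \<omega>|M. iexp (t \<bullet> (sqrt (real n) *\<^sub>R (\<beta>hat n \<omega> - \<beta>)))) \<longlonglongrightarrow>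
     complex_of_real (exp (- ((\<sigma> istar)\<^sup>2 * (t \<bullet> (matrix_inv Sg *v t))) / 2))" for t
    unfolding var[OF k] Sg_def
  proof (rule max_criterion_minimizer_iexp_limit[OF _ k rows])
    show "finite I" by (simp add: I_def)
    show "positive_definite (\<integral>v. outer_square v \<partial>Fx)" by (rule xx_pos_def)
    show "(\<integral>y. y\<^sup>2 \<partial>F i) < (\<integral>y. y\<^sup>2 \<partial>F istar)" if "i \<in> I" "i \<noteq> istar" for i
      using istar_strict[of i] that by (simp add: var[symmetric] k) (simp add: I_def)
    show "random_variable borel (\<lambda>\<omega>. \<beta>hat n \<omega> - \<beta>)" for n
      using \<beta>hat_measurable by measurable
    fix n \<omega> assume n: "0 < (n::nat)" and \<omega>: "\<omega> \<in> space M"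
    have "is_arg_min (\<lambda>d. max_group_mse m n (\<lambda>i j. Y i j \<omega>) (\<lambda>i j. x i j \<omega>) (d + \<beta>)) (\<lambda>_. True) (\<beta>hat n \<omega> - \<beta>)"
      using \<beta>hat_argmin[of n \<omega>] n \<omega> by (intro is_arg_min_shift) simp
    moreover have "max_group_mse m n (\<lambda>i j. Y i j \<omega>) (\<lambda>i j. x i j \<omega>) (d + \<beta>) =
        (MAX i\<in>I. 1 / real n * (\<Sum>j<n. (e i (Suc j) \<omega> - d \<bullet> x i (Suc j) \<omega>)\<^sup>2))" for d
      unfolding I_def by (rule max_group_mse_reparametrized[where e = "\<lambda>i j. e i j \<omega>"]) (rule model[OF _ _ \<omega>])
    ultimately show "is_arg_min (\<lambda>b. MAX i\<in>I. 1 / real n * (\<Sum>j<n. (e i (Suc j) \<omega> - b \<bullet> x i (Suc j) \<omega>)\<^sup>2))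
        (\<lambda>_. True) (\<beta>hat n \<omega> - \<beta>)"
      by (simp only:)
  qed
  obtain U :: "real^'p^'p" where U: "U ** transpose U = matrix_inv Sg"
    using positive_definite_inverse_factor xx_pos_def unfolding Sg_def by blast
  define A where "A = \<sigma> istar *\<^sub>R U"
  have A: "A ** transpose A = (\<sigma> istar)\<^sup>2 *\<^sub>R matrix_inv Sg"
    by (simp add: A_def U[symmetric] transpose_scalar matrix_scalar_ac scalar_matrix_assoc[symmetric] power2_eq_square)
  define L where "L = distr std_normal_vec borel (\<lambda>z. A *v z)"
  have [measurable]: "(\<lambda>z. A *v z) \<in> borel_measurable borel"
    by (intro borel_measurable_continuous_onI matrix_vector_mult_linear_continuous_on)
  have "is_normal_law 0 ((\<sigma> istar)\<^sup>2 *\<^sub>R matrix_inv Sg) L"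
    unfolding is_normal_law_def L_def using A by (intro exI[of _ A]) simp
  moreover have "converges_in_distribution M (\<lambda>n \<omega>. sqrt (real n) *\<^sub>R (\<beta>hat n \<omega> - \<beta>)) L"
    unfolding converges_in_distribution_def
  proof (intro allI impI, elim conjE)
    fix f :: "real^'p \<Rightarrow> real" assume f: "continuous_on UNIV f" "bounded (range f)"
    let ?T = "\<lambda>n \<omega>. sqrt (real n) *\<^sub>R (\<beta>hat n \<omega> - \<beta>)"
    have T: "random_variable borel (?T n)" for n using \<beta>hat_measurable by measurable
    have "(\<lambda>n. \<integral>v. f v \<partial>distr M borel (?T n)) \<longlonglongrightarrow> (\<integral>v. f v \<partial>L)"
    proof (rule levy_continuity_vec[OF _ _ _ _ _ f])
      show "prob_space (distr M borel (?T n))" for n by (rule prob_space_distr[OF T])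
      show "prob_space L"
        unfolding L_def by (rule prob_space.prob_space_distr[OF prob_space_std_normal_vec]) measurable
      show "(\<lambda>n. char_vec (distr M borel (?T n)) t) \<longlonglongrightarrow> char_vec L t" for t
        using lim[of t] unfolding L_def char_vec_normal_image A char_vec_distr[OF T]
        by (simp add: scaleR_matrix_vector_assoc[symmetric])
    qed (simp_all add: L_def)
    moreover have "(\<integral>v. f v \<partial>distr M borel (?T n)) = (\<integral>\<omega>. f (?T n \<omega>) \<partial>M)" for n
      using T borel_measurable_continuous_onI[OF f(1)] by (rule integral_distr)
    ultimately show "(\<lambda>n. \<integral>\<omega>. f (?T n \<omega>) \<partial>M) \<longlonglongrightarrow> (\<integral>v. f v \<partial>L)" by simp
  qed
  ultimately show ?thesis unfolding Sg_def by blast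
qed

end
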